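(* Let $\alpha,\beta\ge0$ with $\alpha+\beta>0$. (a) For every $(f_1,f_2)\in\mathcal C$, $$\lim_{n\to\infty}Q_{n\alpha,n\beta}(f_1,f_2)=Q^{\mathrm{weks}}_{\alpha,\beta}(f_1,f_2),$$ where $Q^{\mathrm{weks}}_{\alpha,\beta}=I_{\mathcal C}-P^{\mathrm{skew}}_{\alpha,\beta}$. (b) The map $Q^{\mathrm{weks}}_{\alpha,\beta}$ is a projection on the space $$\mathcal D^{\mathrm{weks}}_{\alpha,\beta}=\{(g_1,g_2)\in\mathcal C:\ g_1^e=-g_2^e,\ \alpha g_1^o=-\beta g_2^o\}.$$ (c) The space $\mathcal D^{\mathrm{weks}}_{\alpha,\beta}$ is the subspace of extensions related to the generator $A^{\mathrm{weks}}_{\alpha,\beta}$, that is, $\mathcal D^{\mathrm{weks}}_{\alpha,\beta}=\{E^{\mathrm{weks}}_{\alpha,\beta}f:\ f\in\mathfrak C_{\mathrm{ov}}(\mathbb R_\sharp)\}$.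
   Context: $\mathfrak C[-\infty,\infty]$ is the space of real continuous functions on $\mathbb R$ with finite limits at $\pm\infty$ (supremum norm); $\mathcal C=(\mathfrak C[-\infty,\infty])^2$ with a usual product norm (e.g. maximum norm); $I_{\mathcal C}$ is its identity operator. $\mathfrak C_{\mathrm{ov}}(\mathbb R_\sharp)$ is the space of real continuous functions on $(-\infty,0)\cup(0,\infty)$ with finite limits at $\pm\infty$ and finite one-sided limits at $0$ satisfying $f(0+)=-f(0-)$. For a function $f$ on $\mathbb R$: $f^{T}(x)=f(-x)$, $f^e=\frac12(f+f^{T})$, $f^o=\frac12(f-f^{T})$. $\sinh_a(x)=\sinh(ax)$, $\cosh_a(x)=\cosh(ax)$; $(f*g)(x)=\int_0^xf(x-y)g(y)\,dy$ for all $x\in\mathbb R$; $\widehat f(\lambda)=\int_0^\infty e^{-\lambda x}f(x)\,dx$. For any $\alpha,\beta\ge0$ with $\alpha+\beta>0$, put $\gamma=\sqrt{2(\alpha^2+\beta^2)}$ and, for $(f_1,f_2)\in\mathcal C$, $k_1=\alpha f_1^o+\beta f_2^o$, $k_2=f_1^e-f_2^e$, $c=\widehat{k_1}(\gamma)+\frac\gamma2\widehat{k_2}(\gamma)$. Then $P_{\alpha,\beta}(f_1,f_2)=(g_1,g_2)$ with, on $\mathbb R$, $$g_1=f_1^e+c\left(\tfrac{2\alpha}{\gamma}\sinh_\gamma-\cosh_\gamma\right)-\left(\tfrac{2\alpha}{\gamma}k_1-\tfrac{\gamma}{2}k_2\right)*\sinh_\gamma+(k_1-\alpha k_2)*\cosh_\gamma,$$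 $$g_2=f_2^e+c\left(\tfrac{2\beta}{\gamma}\sinh_\gamma+\cosh_\gamma\right)-\left(\tfrac{2\beta}{\gamma}k_1+\tfrac{\gamma}{2}k_2\right)*\sinh_\gamma-(k_1+\beta k_2)*\cosh_\gamma,$$ and $Q_{\alpha,\beta}=I_{\mathcal C}-P_{\alpha,\beta}$. $Q_{n\alpha,n\beta}$ is the same with $(\alpha,\beta)$ replaced by $(n\alpha,n\beta)$ throughout. Also $$P^{\mathrm{skew}}_{\alpha,\beta}(f_1,f_2)=\left(f_1^e+\tfrac{2\alpha}{\gamma^2}k_1-\tfrac12k_2,\ f_2^e+\tfrac{2\beta}{\gamma^2}k_1+\tfrac12k_2\right).$$ $A^{\mathrm{weks}}_{\alpha,\beta}f=f''$ in $\mathfrak C_{\mathrm{ov}}(\mathbb R_\sharp)$, on the domain of $f$ that are twice continuously differentiable on each side of $0$ with one-sided derivatives at $0$, with finite limits of $f''$ at $\pm\infty$, and with $\beta f'(0+)=-\alpha f'(0-)$, $f''(0+)=-f''(0-)$. The related extension operator $E^{\mathrm{weks}}_{\alpha,\beta}:\mathfrak C_{\mathrm{ov}}(\mathbb R_\sharp)\to\mathcal C$, $E^{\mathrm{weks}}_{\alpha,\beta}f=(\widetilde{f_\ell},\widetilde{f_{\mathrm r}})$, is: $\widetilde{f_\ell}(x)=f(x)$ for $x<0$, $\widetilde{f_\ell}(0)=f(0-)$, $\widetilde{f_\ell}(x)=\frac{\alpha-\beta}{\alpha+\beta}f(-x)-\frac{2\beta}{\alpha+\beta}f(x)$ for $x>0$;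 $\widetilde{f_{\mathrm r}}(x)=-\frac{2\alpha}{\alpha+\beta}f(x)+\frac{\beta-\alpha}{\alpha+\beta}f(-x)$ for $x<0$, $\widetilde{f_{\mathrm r}}(0)=f(0+)$, $\widetilde{f_{\mathrm r}}(x)=f(x)$ for $x>0$. The cosine family generated by $A^{\mathrm{weks}}_{\alpha,\beta}$ is obtained by applying $\frac12[g(x+t)+g(x-t)]$ to both coordinates of $E^{\mathrm{weks}}_{\alpha,\beta}f$ and taking the first coordinate for $x<0$ and the second for $x>0$; the "subspace of extensions" is the range of $E^{\mathrm{weks}}_{\alpha,\beta}$. A projection on a subspace is an idempotent bounded linear operator with that subspace as range. *)

theory Defs
  imports "HOL-Analysis.Analysis"
begin

section \<open>The space of continuous functions on the line with finite limits at both ends\<close>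

typedef lim_cont =
  "{f :: real \<Rightarrow> real. continuous_on UNIV f \<and> (\<exists>l. (f \<longlongrightarrow> l) at_bot) \<and> (\<exists>l. (f \<longlongrightarrow> l) at_top)}"
  morphisms app Lim_cont
  by (rule exI[of _ "\<lambda>_. 0"]) auto

setup_lifting type_definition_lim_cont

lemma bounded_range_if_limits:
  fixes f :: "real \<Rightarrow> real"
  assumes "continuous_on UNIV f" "(f \<longlongrightarrow> l) at_bot" "(f \<longlongrightarrow> m) at_top"
  shows "bounded (range f)"
proof -
  have "eventually (\<lambda>x. dist (f x) l < 1) at_bot" "eventually (\<lambda>x. dist (f x) m < 1) at_top"
    using assms by (auto simp: tendsto_iff)
  then obtain a b where a: "\<And>x. x \<le> a \<Longrightarrow> dist (f x) l < 1" and b: "\<And>x. x \<ge> b \<Longrightarrow> dist (f x) m < 1"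
    by (auto simp: eventually_at_bot_linorder eventually_at_top_linorder)
  have "compact (f ` {a..b})"
    using assms(1) by (intro compact_continuous_image) (auto intro: continuous_on_subset)
  then have "bounded (f ` {a..b})" by (rule compact_imp_bounded)
  moreover have "range f \<subseteq> ball l 1 \<union> ball m 1 \<union> f ` {a..b}"
  proof
    fix y assume "y \<in> range f"
    then obtain x where x: "y = f x" by auto
    then show "y \<in> ball l 1 \<union> ball m 1 \<union> f ` {a..b}"
      using a[of x] b[of x] by (cases "x \<le> a"; cases "x \<ge> b") (auto simp: dist_commute)
  qed
  ultimately show ?thesis
    by (meson bounded_Un bounded_ball bounded_subset)
qed

lemma bounded_app: "bounded (range (app f))"
  using app[of f] bounded_range_if_limits by auto

lemma bdd_above_app: "bdd_above (range (\<lambda>x. \<bar>app f x\<bar>))"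
  using bounded_app[of f] by (auto simp: bounded_iff bdd_above_def)

instantiation lim_cont :: real_vector
begin
lift_definition zero_lim_cont :: lim_cont is "\<lambda>_. 0" by auto
lift_definition plus_lim_cont :: "lim_cont \<Rightarrow> lim_cont \<Rightarrow> lim_cont" is "\<lambda>f g x. f x + g x"
  by (auto intro!: continuous_intros intro: tendsto_add)
lift_definition minus_lim_cont :: "lim_cont \<Rightarrow> lim_cont \<Rightarrow> lim_cont" is "\<lambda>f g x. f x - g x"
  by (auto intro!: continuous_intros intro: tendsto_diff)
lift_definition uminus_lim_cont :: "lim_cont \<Rightarrow> lim_cont" is "\<lambda>f x. - f x"
  by (auto intro!: continuous_intros intro: tendsto_minus)
lift_definition scaleR_lim_cont :: "real \<Rightarrow> lim_cont \<Rightarrow> lim_cont" is "\<lambda>r f x. r * f x"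
  by (auto intro!: continuous_intros intro: tendsto_mult_left)
instance
  by standard (transfer, force simp: algebra_simps)+
end

instantiation lim_cont :: real_normed_vector
begin
definition norm_lim_cont_def: "norm (f::lim_cont) = (SUP x. \<bar>app f x\<bar>)"
definition dist_lim_cont_def: "dist (f::lim_cont) g = norm (f - g)"
definition sgn_lim_cont_def: "sgn (f::lim_cont) = inverse (norm f) *\<^sub>R f"
definition uniformity_lim_cont_def: "(uniformity :: (lim_cont \<times> lim_cont) filter) = (INF e\<in>{0<..}. principal {(f, g). dist f g < e})"
definition open_lim_cont_def: "open (U::lim_cont set) \<longleftrightarrow> (\<forall>f\<in>U. eventually (\<lambda>(f', g). f' = f \<longrightarrow> g \<in> U) uniformity)"
instance
proof
  fix f g :: lim_cont and r :: real
  have le: "\<bar>app h x\<bar> \<le> norm h" for h x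
    unfolding norm_lim_cont_def by (rule cSUP_upper) (auto simp: bdd_above_app)
  have least: "norm h \<le> B" if "\<And>x. \<bar>app h x\<bar> \<le> B" for h B
    unfolding norm_lim_cont_def using that by (intro cSUP_least) auto
  show "norm f = 0 \<longleftrightarrow> f = 0"
  proof
    assume "norm f = 0"
    then have "app f x = 0" for x using le[of f x] by auto
    then show "f = 0" by (metis app_inject ext zero_lim_cont.rep_eq)
  qed (simp add: norm_lim_cont_def zero_lim_cont.rep_eq)
  show "norm (f + g) \<le> norm f + norm g"
  proof (rule least)
    fix x show "\<bar>app (f + g) x\<bar> \<le> norm f + norm g"
      using le[of f x] le[of g x] by (simp add: plus_lim_cont.rep_eq)
  qed
  have sc: "norm (s *\<^sub>R h) \<le> \<bar>s\<bar> * norm h" for s :: real and h :: lim_cont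
    by (rule least) (auto simp: scaleR_lim_cont.rep_eq abs_mult intro!: mult_left_mono le)
  show "norm (r *\<^sub>R f) = \<bar>r\<bar> * norm f"
  proof (cases "r = 0")
    case True
    then show ?thesis by (simp add: norm_lim_cont_def zero_lim_cont.rep_eq)
  next
    case False
    have "norm (inverse r *\<^sub>R (r *\<^sub>R f)) \<le> \<bar>inverse r\<bar> * norm (r *\<^sub>R f)" by (rule sc)
    then have "norm f \<le> norm (r *\<^sub>R f) / \<bar>r\<bar>" using False by (simp add: field_simps)
    then show ?thesis using sc[of r f] False by (simp add: field_simps)
  qed
qed (simp_all add: dist_lim_cont_def sgn_lim_cont_def uniformity_lim_cont_def open_lim_cont_def)
end

text \<open>Pairs are measured in the library's norm on product types,
  \<open>norm (f, g) = sqrt ((norm f)\<^sup>2 + (norm g)\<^sup>2)\<close>, which is equivalent to the maximum norm.\<close>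

type_synonym lim_cont2 = "lim_cont \<times> lim_cont"

lift_definition reflect :: "lim_cont \<Rightarrow> lim_cont" is "\<lambda>f x. f (- x)"
proof (safe)
  fix f :: "real \<Rightarrow> real" and l m
  assume f: "continuous_on UNIV f" "(f \<longlongrightarrow> l) at_bot" "(f \<longlongrightarrow> m) at_top"
  show "continuous_on UNIV (\<lambda>x. f (- x))"
    using f(1) by (auto intro!: continuous_intros intro: continuous_on_compose2)
  show "\<exists>l. ((\<lambda>x. f (- x)) \<longlongrightarrow> l) at_bot" "\<exists>l. ((\<lambda>x. f (- x)) \<longlongrightarrow> l) at_top"
    using f filterlim_compose[OF f(2) filterlim_uminus_at_bot_at_top]
      filterlim_compose[OF f(3) filterlim_uminus_at_top_at_bot] by auto
qed

definition even_part :: "lim_cont \<Rightarrow> lim_cont" where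
  "even_part f = (1/2) *\<^sub>R (f + reflect f)"

definition odd_part :: "lim_cont \<Rightarrow> lim_cont" where
  "odd_part f = (1/2) *\<^sub>R (f - reflect f)"

section \<open>The operators \<open>P\<close>, \<open>Q\<close> and their skew limits\<close>

text \<open>The interval integral is oriented, so this covers negative \<open>x\<close> as well.\<close>

definition conv :: "(real \<Rightarrow> real) \<Rightarrow> (real \<Rightarrow> real) \<Rightarrow> real \<Rightarrow> real" where
  "conv f g x = (LBINT y=0..x. f (x - y) * g y)"

definition laplace :: "(real \<Rightarrow> real) \<Rightarrow> real \<Rightarrow> real" where
  "laplace f s = (LBINT x:{0..}. exp (- s * x) * f x)"

definition gam :: "real \<Rightarrow> real \<Rightarrow> real" where
  "gam \<alpha> \<beta> = sqrt (2 * (\<alpha>\<^sup>2 + \<beta>\<^sup>2))"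

definition k1 :: "real \<Rightarrow> real \<Rightarrow> lim_cont2 \<Rightarrow> lim_cont" where
  "k1 \<alpha> \<beta> F = \<alpha> *\<^sub>R odd_part (fst F) + \<beta> *\<^sub>R odd_part (snd F)"

definition k2 :: "lim_cont2 \<Rightarrow> lim_cont" where
  "k2 F = even_part (fst F) - even_part (snd F)"

definition cconst :: "real \<Rightarrow> real \<Rightarrow> lim_cont2 \<Rightarrow> real" where
  "cconst \<alpha> \<beta> F =
     laplace (app (k1 \<alpha> \<beta> F)) (gam \<alpha> \<beta>) + gam \<alpha> \<beta> / 2 * laplace (app (k2 F)) (gam \<alpha> \<beta>)"

definition P_fst :: "real \<Rightarrow> real \<Rightarrow> lim_cont2 \<Rightarrow> real \<Rightarrow> real" where
  "P_fst \<alpha> \<beta> F x =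
     (let \<gamma> = gam \<alpha> \<beta>; \<kappa>\<^sub>1 = app (k1 \<alpha> \<beta> F); \<kappa>\<^sub>2 = app (k2 F) in
      app (even_part (fst F)) x
      + cconst \<alpha> \<beta> F * (2 * \<alpha> / \<gamma> * sinh (\<gamma> * x) - cosh (\<gamma> * x))
      - conv (\<lambda>y. 2 * \<alpha> / \<gamma> * \<kappa>\<^sub>1 y - \<gamma> / 2 * \<kappa>\<^sub>2 y) (\<lambda>y. sinh (\<gamma> * y)) x
      + conv (\<lambda>y. \<kappa>\<^sub>1 y - \<alpha> * \<kappa>\<^sub>2 y) (\<lambda>y. cosh (\<gamma> * y)) x)"

definition P_snd :: "real \<Rightarrow> real \<Rightarrow> lim_cont2 \<Rightarrow> real \<Rightarrow> real" where
  "P_snd \<alpha> \<beta> F x =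
     (let \<gamma> = gam \<alpha> \<beta>; \<kappa>\<^sub>1 = app (k1 \<alpha> \<beta> F); \<kappa>\<^sub>2 = app (k2 F) in
      app (even_part (snd F)) x
      + cconst \<alpha> \<beta> F * (2 * \<beta> / \<gamma> * sinh (\<gamma> * x) + cosh (\<gamma> * x))
      - conv (\<lambda>y. 2 * \<beta> / \<gamma> * \<kappa>\<^sub>1 y + \<gamma> / 2 * \<kappa>\<^sub>2 y) (\<lambda>y. sinh (\<gamma> * y)) x
      - conv (\<lambda>y. \<kappa>\<^sub>1 y + \<beta> * \<kappa>\<^sub>2 y) (\<lambda>y. cosh (\<gamma> * y)) x)"

text \<open>Both coordinates are continuous with finite limits whenever \<open>\<alpha> + \<beta> > 0\<close>, so that
  \<open>Lim_cont\<close> does not change them; see lemma \<open>app_P\<close> below.\<close>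

definition P :: "real \<Rightarrow> real \<Rightarrow> lim_cont2 \<Rightarrow> lim_cont2" where
  "P \<alpha> \<beta> F = (Lim_cont (P_fst \<alpha> \<beta> F), Lim_cont (P_snd \<alpha> \<beta> F))"

definition Q :: "real \<Rightarrow> real \<Rightarrow> lim_cont2 \<Rightarrow> lim_cont2" where
  "Q \<alpha> \<beta> F = F - P \<alpha> \<beta> F"

definition P_skew :: "real \<Rightarrow> real \<Rightarrow> lim_cont2 \<Rightarrow> lim_cont2" where
  "P_skew \<alpha> \<beta> F =
     (even_part (fst F) + (2 * \<alpha> / (gam \<alpha> \<beta>)\<^sup>2) *\<^sub>R k1 \<alpha> \<beta> F - (1/2) *\<^sub>R k2 F,
      even_part (snd F) + (2 * \<beta> / (gam \<alpha> \<beta>)\<^sup>2) *\<^sub>R k1 \<alpha> \<beta> F + (1/2) *\<^sub>R k2 F)"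

definition Q_weks :: "real \<Rightarrow> real \<Rightarrow> lim_cont2 \<Rightarrow> lim_cont2" where
  "Q_weks \<alpha> \<beta> F = F - P_skew \<alpha> \<beta> F"

definition is_projection_on :: "('a::real_normed_vector \<Rightarrow> 'a) \<Rightarrow> 'a set \<Rightarrow> bool" where
  "is_projection_on T S \<longleftrightarrow> bounded_linear T \<and> (\<forall>x. T (T x) = T x) \<and> range T = S"

definition D_weks :: "real \<Rightarrow> real \<Rightarrow> lim_cont2 set" where
  "D_weks \<alpha> \<beta> = {(g\<^sub>1, g\<^sub>2). even_part g\<^sub>1 = - even_part g\<^sub>2 \<and>
                          \<alpha> *\<^sub>R odd_part g\<^sub>1 = - (\<beta> *\<^sub>R odd_part g\<^sub>2)}"

section \<open>The extension operator\<close>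

text \<open>Functions on the punctured line are represented by functions on the line whose value at 0 is
  irrelevant.\<close>

definition C_ov :: "(real \<Rightarrow> real) set" where
  "C_ov = {f. continuous_on (- {0}) f \<and> (\<exists>l. (f \<longlongrightarrow> l) at_bot) \<and> (\<exists>l. (f \<longlongrightarrow> l) at_top) \<and>
              (\<exists>l. (f \<longlongrightarrow> l) (at_right 0) \<and> (f \<longlongrightarrow> - l) (at_left 0))}"

definition E_left :: "real \<Rightarrow> real \<Rightarrow> (real \<Rightarrow> real) \<Rightarrow> real \<Rightarrow> real" where
  "E_left \<alpha> \<beta> f x =
     (if x < 0 then f x
      else if x = 0 then Lim (at_left 0) f
      else (\<alpha> - \<beta>) / (\<alpha> + \<beta>) * f (- x) - 2 * \<beta> / (\<alpha> + \<beta>) * f x)"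

definition E_right :: "real \<Rightarrow> real \<Rightarrow> (real \<Rightarrow> real) \<Rightarrow> real \<Rightarrow> real" where
  "E_right \<alpha> \<beta> f x =
     (if x < 0 then - (2 * \<alpha> / (\<alpha> + \<beta>)) * f x + (\<beta> - \<alpha>) / (\<alpha> + \<beta>) * f (- x)
      else if x = 0 then Lim (at_right 0) f
      else f x)"

text \<open>For \<open>f \<in> C_ov\<close> and \<open>\<alpha> + \<beta> > 0\<close> both coordinates are continuous with finite limits; see
  lemma \<open>app_E_weks\<close> below.\<close>

definition E_weks :: "real \<Rightarrow> real \<Rightarrow> (real \<Rightarrow> real) \<Rightarrow> lim_cont2" where
  "E_weks \<alpha> \<beta> f = (Lim_cont (E_left \<alpha> \<beta> f), Lim_cont (E_right \<alpha> \<beta> f))"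

section \<open>Well-definedness of \<open>P\<close> and of the extension operator\<close>

lemma app_simps [simp]:
  "app 0 x = 0" "app (f + g) x = app f x + app g x" "app (f - g) x = app f x - app g x"
  "app (- f) x = - app f x" "app (r *\<^sub>R f) x = r * app f x" "app (reflect f) x = app f (- x)"
  by (transfer, simp)+

lemma continuous_app [continuous_intros]:
  "continuous_on S g \<Longrightarrow> continuous_on S (\<lambda>x. app f (g x))"
  using app[of f] by (auto intro: continuous_on_compose2)

lemma app_limits: "\<exists>l. (app f \<longlongrightarrow> l) at_bot" "\<exists>l. (app f \<longlongrightarrow> l) at_top"
  using app[of f] by auto

lemma conv_eq:
  assumes "x \<ge> 0"
  shows "conv f g x = (LBINT y:{0..x}. f (x - y) * g y)"
  using assms unfolding conv_def zero_ereal_def by (subst interval_integral_Icc) auto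

lemma integrable_prod:
  fixes f g :: "real \<Rightarrow> real"
  assumes "continuous_on UNIV f" "continuous_on UNIV g"
  shows "set_integrable lborel {0..x} (\<lambda>y. f (x - y) * g y)"
proof -
  have "continuous_on {0..x} (\<lambda>y. f (x - y) * g y)"
    by (intro continuous_intros continuous_on_compose2[OF assms(1)] continuous_on_compose2[OF assms(2)]) auto
  then show ?thesis by (rule borel_integrable_atLeastAtMost')
qed

lemma conv_lin:
  assumes "x \<ge> 0" "continuous_on UNIV f" "continuous_on UNIV f'" "continuous_on UNIV g" "continuous_on UNIV g'"
  shows "conv (\<lambda>y. a * f y + b * f' y) g x = a * conv f g x + b * conv f' g x"
    and "conv f (\<lambda>y. a * g y + b * g' y) x = a * conv f g x + b * conv f g' x"
proof -
  note I = integrable_prod[OF assms(2,4), of x] integrable_prod[OF assms(3,4), of x]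
     integrable_prod[OF assms(2,5), of x]
  have "(LBINT y:{0..x}. (a * f (x - y) + b * f' (x - y)) * g y)
      = (LBINT y:{0..x}. a * (f (x - y) * g y) + b * (f' (x - y) * g y))"
    by (simp add: algebra_simps)
  also have "\<dots> = a * (LBINT y:{0..x}. f (x - y) * g y) + b * (LBINT y:{0..x}. f' (x - y) * g y)"
    using I by (subst set_integral_add) auto
  finally show "conv (\<lambda>y. a * f y + b * f' y) g x = a * conv f g x + b * conv f' g x"
    using assms(1) by (simp add: conv_eq)
  have "(LBINT y:{0..x}. f (x - y) * (a * g y + b * g' y))
      = (LBINT y:{0..x}. a * (f (x - y) * g y) + b * (f (x - y) * g' y))"
    by (simp add: algebra_simps)
  also have "\<dots> = a * (LBINT y:{0..x}. f (x - y) * g y) + b * (LBINT y:{0..x}. f (x - y) * g' y)"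
    using I by (subst set_integral_add) auto
  finally show "conv f (\<lambda>y. a * g y + b * g' y) x = a * conv f g x + b * conv f g' x"
    using assms(1) by (simp add: conv_eq)
qed

lemma conv_minus: "conv f g (- x) = - conv (\<lambda>y. f (- y)) (\<lambda>y. g (- y)) x"
  unfolding conv_def
  by (subst interval_integral_reflect, subst interval_integral_endpoints_reverse) simp

definition expint :: "real \<Rightarrow> (real \<Rightarrow> real) \<Rightarrow> real \<Rightarrow> real" where
  "expint s f x = integral {0..x} (\<lambda>u. exp (- s * u) * f u)"

lemma conv_exp:
  assumes "x \<ge> 0" and f: "continuous_on UNIV f"
  shows "conv f (\<lambda>y. exp (s * y)) x = exp (s * x) * expint s f x"
proof -
  have c: "continuous_on {0..x} (\<lambda>u. exp (- s * u) * f u)"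
    by (intro continuous_intros continuous_on_subset[OF f]) auto
  have "conv f (\<lambda>y. exp (s * y)) x = (\<integral>y. indicator {0..x} y * (f (x - y) * exp (s * y)) \<partial>lborel)"
    using assms(1) by (simp add: conv_eq set_lebesgue_integral_def)
  also have "\<dots> = (\<integral>u. indicator {0..x} (x - u) * (f u * exp (s * (x - u))) \<partial>lborel)"
    by (subst lborel_integral_real_affine[where c = "-1" and t = x]) auto
  also have "\<dots> = (\<integral>u. exp (s * x) * (indicator {0..x} u * (exp (- s * u) * f u)) \<partial>lborel)"
    by (rule Bochner_Integration.integral_cong)
       (auto simp: indicator_def algebra_simps exp_diff exp_minus field_simps)
  also have "\<dots> = exp (s * x) * (LBINT u:{0..x}. exp (- s * u) * f u)"
    by (simp add: set_lebesgue_integral_def)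
  also have "(LBINT u:{0..x}. exp (- s * u) * f u) = expint s f x"
    unfolding expint_def by (rule set_borel_integral_eq_integral(2)[OF borel_integrable_atLeastAtMost'[OF c]])
  finally show ?thesis .
qed

lemma expint_deriv:
  assumes f: "continuous_on UNIV f" and "x > 0"
  shows "(expint s f has_real_derivative exp (- s * x) * f x) (at x)"
proof -
  have "continuous_on {0..x+1} (\<lambda>u. exp (- s * u) * f u)"
    by (intro continuous_intros continuous_on_subset[OF f]) auto
  then have "((\<lambda>x. integral {0..x} (\<lambda>u. exp (- s * u) * f u)) has_real_derivative exp (- s * x) * f x)
     (at x within {0..x+1})"
    using assms(2) by (intro integral_has_real_derivative) auto
  moreover have "at x within {0..x+1} = at x"
    using assms(2) by (intro at_within_interior) auto
  ultimately show ?thesis unfolding expint_def[abs_def] by simp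
qed

lemma expint_continuous:
  assumes f: "continuous_on UNIV f"
  shows "continuous_on {0..b} (expint s f)"
  unfolding expint_def[abs_def]
  by (intro indefinite_integral_continuous_1 integrable_continuous_interval continuous_intros
        continuous_on_subset[OF f]) auto

lemma expint_continuous':
  assumes f: "continuous_on UNIV f"
  shows "continuous_on {0..} (expint s f)"
proof (rule continuous_on_eq_continuous_within[THEN iffD2], rule ballI)
  fix x :: real assume x: "x \<in> {0..}"
  have "continuous (at x within {0..x+1}) (expint s f)"
    using expint_continuous[OF f, of "x+1" s] x by (simp add: continuous_on_eq_continuous_within)
  moreover have "at x within {0..x+1} = at x within {0..}"
    by (rule at_within_nhd[where S = "{x - 1<..<x + 1}"]) (use x in auto)
  ultimately show "continuous (at x within {0..}) (expint s f)" by (simp add: continuous_within)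
qed

lemma lim_decaying:
  assumes f: "continuous_on UNIV f" and L: "(f \<longlongrightarrow> L) at_top" and s: "s > 0"
  shows "((\<lambda>x. exp (- s * x) * expint (- s) f x) \<longlongrightarrow> L / s) at_top"
proof -
  have "((\<lambda>x. expint (- s) f x / exp (s * x)) \<longlongrightarrow> L / s) at_top"
  proof (rule lhospital_at_top_at_top)
    show "LIM x at_top. exp (s * x) :> at_top"
      using s by (intro filterlim_compose[OF exp_at_top] filterlim_tendsto_pos_mult_at_top[OF tendsto_const]
            filterlim_ident) auto
    show "eventually (\<lambda>x. s * exp (s * x) \<noteq> 0) at_top" using s by auto
    show "eventually (\<lambda>x. (expint (- s) f has_real_derivative exp (s * x) * f x) (at x)) at_top"
      using eventually_gt_at_top[of 0] by eventually_elim (use expint_deriv[OF f, of _ "- s"] in auto)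
    show "eventually (\<lambda>x. ((\<lambda>x. exp (s * x)) has_real_derivative s * exp (s * x)) (at x)) at_top"
      by (intro always_eventually allI) (auto intro!: derivative_eq_intros)
    have "((\<lambda>x. f x / s) \<longlongrightarrow> L / s) at_top" using s by (intro tendsto_intros L) auto
    then show "((\<lambda>x. exp (s * x) * f x / (s * exp (s * x))) \<longlongrightarrow> L / s) at_top"
      by (simp add: mult.commute)
  qed
  then show ?thesis by (simp add: exp_minus field_simps)
qed

lemma exp_integrable:
  assumes "s > 0"
  shows "set_integrable lborel {0..} (\<lambda>x::real. exp (- s * x))"
proof -
  have "(\<lambda>x. exp (- s * x) :: real) absolutely_integrable_on {0..}"
    using integrable_on_exp_minus_to_infinity[OF assms, of 0]
    by (intro nonnegative_absolutely_integrable_1) auto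
  then have "set_integrable lebesgue {0..} (\<lambda>x::real. exp (- s * x))" .
  then show ?thesis
    unfolding set_integrable_def by (subst (asm) integrable_completion) auto
qed

lemma laplace_integrable:
  fixes f :: "real \<Rightarrow> real"
  assumes f: "continuous_on UNIV f" and B: "\<And>x. \<bar>f x\<bar> \<le> B" and s: "s > 0"
  shows "set_integrable lborel {0..} (\<lambda>x. exp (- s * x) * f x)"
proof -
  have [measurable]: "f \<in> borel_measurable borel" using f by (rule borel_measurable_continuous_onI)
  have "set_integrable lborel {0..} (\<lambda>x. B * exp (- s * x))"
    using exp_integrable[OF s] by simp
  then show ?thesis
  proof (rule set_integrable_bound)
    show "set_borel_measurable lborel {0..} (\<lambda>x. exp (- s * x) * f x)"
      unfolding set_borel_measurable_def by measurable
    show "AE x in lborel. x \<in> {0..} \<longrightarrow> norm (exp (- s * x) * f x) \<le> norm (B * exp (- s * x))"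
      using B by (auto simp: abs_mult mult.commute intro!: mult_right_mono order_trans[OF B])
  qed
qed

lemma lim_growing:
  fixes f :: "real \<Rightarrow> real"
  assumes f: "continuous_on UNIV f" and L: "(f \<longlongrightarrow> L) at_top" and s: "s > 0"
    and B: "\<And>x. \<bar>f x\<bar> \<le> B"
  shows "((\<lambda>x. exp (s * x) * (laplace f s - expint s f x)) \<longlongrightarrow> laplace (\<lambda>_. L) s) at_top"
proof -
  have [measurable]: "f \<in> borel_measurable borel" using f by (rule borel_measurable_continuous_onI)
  have c: "continuous_on {0..x} (\<lambda>u. exp (- s * u) * f u)" for x
    by (intro continuous_intros continuous_on_subset[OF f]) auto
  have I: "set_integrable lborel {0..} (\<lambda>x. exp (- s * x) * f x)"
    by (rule laplace_integrable[OF f B s])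
  have eq: "exp (s * x) * (laplace f s - expint s f x)
     = (\<integral>v. indicator {0..} v * (exp (- s * v) * f (x + v)) \<partial>lborel)" if x: "x \<ge> 0" for x
  proof -
    have "expint s f x = (LBINT u:{0..x}. exp (- s * u) * f u)"
      unfolding expint_def
      by (rule set_borel_integral_eq_integral(2)[OF borel_integrable_atLeastAtMost'[OF c], symmetric])
    moreover have "laplace f s = (LBINT u:{0..x}. exp (- s * u) * f u) + (LBINT u:{x<..}. exp (- s * u) * f u)"
    proof -
      have "{0..} = {0..x} \<union> {x<..}" using x by auto
      then show ?thesis
        unfolding laplace_def using x
        by (simp only:) (intro set_integral_Un set_integrable_subset[OF I]; force)
    qed
    ultimately have "exp (s * x) * (laplace f s - expint s f x)
       = exp (s * x) * (LBINT u:{x<..}. exp (- s * u) * f u)" by simp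
    also have "(LBINT u:{x<..}. exp (- s * u) * f u) = (LBINT u:{x..}. exp (- s * u) * f u)"
      by (rule set_integral_discrete_difference[where X = "{x}"]) auto
    also have "\<dots> = (\<integral>u. indicator {x..} u * (exp (- s * u) * f u) \<partial>lborel)"
      by (simp add: set_lebesgue_integral_def)
    also have "\<dots> = (\<integral>v. indicator {x..} (x + v) * (exp (- s * (x + v)) * f (x + v)) \<partial>lborel)"
      by (subst lborel_integral_real_affine[where c = 1 and t = x]) auto
    also have "exp (s * x) * \<dots> = (\<integral>v. exp (s * x) * (indicator {x..} (x + v) * (exp (- s * (x + v)) * f (x + v))) \<partial>lborel)"
      by simp
    also have "\<dots> = (\<integral>v. indicator {0..} v * (exp (- s * v) * f (x + v)) \<partial>lborel)"
      by (rule Bochner_Integration.integral_cong)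
         (auto simp: indicator_def algebra_simps exp_diff exp_minus field_simps exp_add)
    finally show ?thesis .
  qed
  have "((\<lambda>x. (\<integral>v. indicator {0..} v * (exp (- s * v) * f (x + v)) \<partial>lborel))
     \<longlongrightarrow> (\<integral>v. indicator {0..} v * (exp (- s * v) * L) \<partial>lborel)) at_top"
  proof (rule integral_dominated_convergence_at_top[where w = "\<lambda>v. B * (indicator {0..} v * exp (- s * v))"])
    show "integrable lborel (\<lambda>v. B * (indicator {0..} v * exp (- s * v)))"
      using exp_integrable[OF s] unfolding set_integrable_def by simp
    show "AE v in lborel. ((\<lambda>x. indicator {0..} v * (exp (- s * v) * f (x + v)))
        \<longlongrightarrow> indicator {0..} v * (exp (- s * v) * L)) at_top"
    proof (rule AE_I2, intro tendsto_intros)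
      fix v :: real
      show "((\<lambda>x. f (x + v)) \<longlongrightarrow> L) at_top"
        by (rule filterlim_compose[OF L]) (auto intro: filterlim_at_top_add_at_top filterlim_tendsto_add_at_top[OF tendsto_const filterlim_ident] simp: add.commute[of _ v])
    qed
    show "\<forall>\<^sub>F x in at_top. AE v in lborel. norm (indicator {0..} v * (exp (- s * v) * f (x + v)))
         \<le> B * (indicator {0..} v * exp (- s * v))"
      using B by (auto simp: indicator_def abs_mult mult.commute intro!: always_eventually mult_right_mono)
  qed measurable
  moreover have "(\<integral>v. indicator {0..} v * (exp (- s * v) * L) \<partial>lborel) = laplace (\<lambda>_. L) s"
    unfolding laplace_def set_lebesgue_integral_def by (rule Bochner_Integration.integral_cong) auto
  ultimately show ?thesis
    using eq by (auto elim!: Lim_transform_eventually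
        intro: eventually_mono[OF eventually_ge_at_top[of 0]])
qed


lemma app_bounded: "\<bar>app f x\<bar> \<le> norm f"
  unfolding norm_lim_cont_def by (rule cSUP_upper) (auto simp: bdd_above_app)

lemma continuous_app_UNIV: "continuous_on UNIV (app f)"
  using app[of f] by auto

text \<open>The common shape of the two coordinates of \<open>P\<close>: the first is \<open>a = \<alpha>\<close>, \<open>r = 1\<close>, the second
  \<open>a = \<beta>\<close>, \<open>r = - 1\<close>.\<close>

definition half :: "lim_cont \<Rightarrow> lim_cont \<Rightarrow> lim_cont \<Rightarrow> real \<Rightarrow> real \<Rightarrow> real \<Rightarrow> real \<Rightarrow> real" where
  "half f p q g a r x = app f x
     + (laplace (app p) g + g / 2 * laplace (app q) g) * (2 * a / g * sinh (g * x) - r * cosh (g * x))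
     - conv (\<lambda>y. 2 * a / g * app p y - r * g / 2 * app q y) (\<lambda>y. sinh (g * y)) x
     + conv (\<lambda>y. r * app p y - a * app q y) (\<lambda>y. cosh (g * y)) x"

lemma half_eq:
  fixes f p q :: lim_cont
  assumes g: "g > 0" and x: "x \<ge> 0"
  defines "H \<equiv> \<lambda>k. exp (g * x) * (laplace (app k) g - expint g (app k) x)"
      and "M \<equiv> \<lambda>k. exp (- g * x) * expint (- g) (app k) x"
  shows "half f p q g a r x = app f x
     - (laplace (app p) g + g / 2 * laplace (app q) g) * (2 * a / g + r) / 2 * exp (- g * x)
     + (2 * a / g) / 2 * (H p + M p) - r * g / 4 * (H q + M q)
     + r / 2 * (M p - H p) - a / 2 * (M q - H q)"
proof -
  have e: "conv (app k) (\<lambda>y. exp (s * y)) x = exp (s * x) * expint s (app k) x" for k s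
    by (rule conv_exp[OF x continuous_app_UNIV])
  have ce: "continuous_on UNIV (\<lambda>y::real. exp (s * y))" for s :: real by (intro continuous_intros)
  have sh: "conv (app k) (\<lambda>y. sinh (g * y)) x = (exp (g * x) * laplace (app k) g - H k - M k) / 2" for k
  proof -
    have "(\<lambda>y. sinh (g * y)) = (\<lambda>y. (1/2) * exp (g * y) + (- 1/2) * exp (- g * y))"
      by (auto simp: sinh_def field_simps)
    then have "conv (app k) (\<lambda>y. sinh (g * y)) x = (1/2) * conv (app k) (\<lambda>y. exp (g * y)) x
       + (- 1/2) * conv (app k) (\<lambda>y. exp (- g * y)) x"
      using conv_lin(2)[OF x continuous_app_UNIV continuous_app_UNIV ce[of g] ce[of "- g"], of k "1/2" "- 1/2"] by simp
    then show ?thesis unfolding e H_def M_def by (simp add: field_simps)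
  qed
  have ch: "conv (app k) (\<lambda>y. cosh (g * y)) x = (exp (g * x) * laplace (app k) g - H k + M k) / 2" for k
  proof -
    have "(\<lambda>y. cosh (g * y)) = (\<lambda>y. (1/2) * exp (g * y) + (1/2) * exp (- g * y))"
      by (auto simp: cosh_def field_simps)
    then have "conv (app k) (\<lambda>y. cosh (g * y)) x = (1/2) * conv (app k) (\<lambda>y. exp (g * y)) x
       + (1/2) * conv (app k) (\<lambda>y. exp (- g * y)) x"
      using conv_lin(2)[OF x continuous_app_UNIV continuous_app_UNIV ce[of g] ce[of "- g"], of k "1/2" "1/2"] by simp
    then show ?thesis unfolding e H_def M_def by (simp add: field_simps)
  qed
  have cs: "continuous_on UNIV (\<lambda>y::real. sinh (g * y))" "continuous_on UNIV (\<lambda>y::real. cosh (g * y))"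
    by (intro continuous_intros)+
  have 1: "conv (\<lambda>y. 2 * a / g * app p y - r * g / 2 * app q y) (\<lambda>y. sinh (g * y)) x
      = 2 * a / g * conv (app p) (\<lambda>y. sinh (g * y)) x - r * g / 2 * conv (app q) (\<lambda>y. sinh (g * y)) x"
    using conv_lin(1)[OF x continuous_app_UNIV[of p] continuous_app_UNIV[of q] cs(1) cs(1), of "2 * a / g" "- (r * g / 2)"]
    by simp
  have 2: "conv (\<lambda>y. r * app p y - a * app q y) (\<lambda>y. cosh (g * y)) x
      = r * conv (app p) (\<lambda>y. cosh (g * y)) x - a * conv (app q) (\<lambda>y. cosh (g * y)) x"
    using conv_lin(1)[OF x continuous_app_UNIV[of p] continuous_app_UNIV[of q] cs(2) cs(2), of r "- a"]
    by simp
  have 3: "sinh (g * x) = (exp (g * x) - exp (- g * x)) / 2" "cosh (g * x) = (exp (g * x) + exp (- g * x)) / 2"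
    by (simp_all add: sinh_def cosh_def)
  show ?thesis
    unfolding half_def 1 2 sh ch unfolding 3 using g by (simp add: field_simps)
qed

lemma half_continuous:
  assumes g: "g > 0" shows "continuous_on {0..} (half f p q g a r)"
proof -
  note [continuous_intros] = expint_continuous'[OF continuous_app_UNIV]
  show ?thesis
    by (subst continuous_on_cong[OF refl half_eq[OF g]], simp)
       (intro continuous_intros subset_refl; use g in simp)
qed

lemma lim_comb:
  fixes f e h\<^sub>1 m\<^sub>1 h\<^sub>2 m\<^sub>2 :: "real \<Rightarrow> real"
  assumes "(f \<longlongrightarrow> F) at_top" "(e \<longlongrightarrow> E) at_top" "(h\<^sub>1 \<longlongrightarrow> H\<^sub>1) at_top" "(m\<^sub>1 \<longlongrightarrow> M\<^sub>1) at_top"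
    "(h\<^sub>2 \<longlongrightarrow> H\<^sub>2) at_top" "(m\<^sub>2 \<longlongrightarrow> M\<^sub>2) at_top"
  shows "\<exists>l. ((\<lambda>x. f x - a * e x + b * (h\<^sub>1 x + m\<^sub>1 x) - c * (h\<^sub>2 x + m\<^sub>2 x) + r * (m\<^sub>1 x - h\<^sub>1 x)
              - s * (m\<^sub>2 x - h\<^sub>2 x)) \<longlongrightarrow> l) at_top"
  by (rule exI[of _ "F - a * E + b * (H\<^sub>1 + M\<^sub>1) - c * (H\<^sub>2 + M\<^sub>2) + r * (M\<^sub>1 - H\<^sub>1) - s * (M\<^sub>2 - H\<^sub>2)"])
     (intro tendsto_intros assms)

lemma half_limit:
  assumes g: "g > 0" shows "\<exists>l. (half f p q g a r \<longlongrightarrow> l) at_top"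
proof -
  obtain F A B where F: "(app f \<longlongrightarrow> F) at_top" and A: "(app p \<longlongrightarrow> A) at_top" and B: "(app q \<longlongrightarrow> B) at_top"
    using app_limits(2) by metis
  have e: "((\<lambda>x. exp (- g * x)) \<longlongrightarrow> 0) at_top"
    using g by (intro filterlim_compose[OF exp_at_bot] filterlim_tendsto_neg_mult_at_bot[OF tendsto_const] filterlim_ident) auto
  note l = lim_decaying[OF continuous_app_UNIV A g] lim_decaying[OF continuous_app_UNIV B g]
    lim_growing[OF continuous_app_UNIV A g app_bounded] lim_growing[OF continuous_app_UNIV B g app_bounded]
  have "\<exists>l. ((\<lambda>x. app f x
     - (laplace (app p) g + g / 2 * laplace (app q) g) * (2 * a / g + r) / 2 * exp (- g * x)
     + (2 * a / g) / 2 * (exp (g * x) * (laplace (app p) g - expint g (app p) x) + exp (- g * x) * expint (- g) (app p) x)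
     - r * g / 4 * (exp (g * x) * (laplace (app q) g - expint g (app q) x) + exp (- g * x) * expint (- g) (app q) x)
     + r / 2 * (exp (- g * x) * expint (- g) (app p) x - exp (g * x) * (laplace (app p) g - expint g (app p) x))
     - a / 2 * (exp (- g * x) * expint (- g) (app q) x - exp (g * x) * (laplace (app q) g - expint g (app q) x))) \<longlongrightarrow> l) at_top"
    by (rule lim_comb[OF F e l(3) l(1) l(4) l(2)])
  then obtain L where L: "((\<lambda>x. app f x
     - (laplace (app p) g + g / 2 * laplace (app q) g) * (2 * a / g + r) / 2 * exp (- g * x)
     + (2 * a / g) / 2 * (exp (g * x) * (laplace (app p) g - expint g (app p) x) + exp (- g * x) * expint (- g) (app p) x)
     - r * g / 4 * (exp (g * x) * (laplace (app q) g - expint g (app q) x) + exp (- g * x) * expint (- g) (app q) x)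
     + r / 2 * (exp (- g * x) * expint (- g) (app p) x - exp (g * x) * (laplace (app p) g - expint g (app p) x))
     - a / 2 * (exp (- g * x) * expint (- g) (app q) x - exp (g * x) * (laplace (app q) g - expint g (app q) x))) \<longlongrightarrow> L) at_top" ..
  have "(half f p q g a r \<longlongrightarrow> L) at_top"
    by (rule Lim_transform_eventually[OF L])
       (rule eventually_mono[OF eventually_ge_at_top[of 0]], rule half_eq[OF g, symmetric])
  then show ?thesis ..
qed

lemma half_minus:
  assumes "\<And>x. app f (- x) = app f x" "\<And>x. app p (- x) = - app p x" "\<And>x. app q (- x) = app q x"
  shows "half f p q g a r (- x) = half f p q g (- a) r x"
proof -
  have 1: "conv (\<lambda>y. 2 * a / g * app p y - r * g / 2 * app q y) (\<lambda>y. sinh (g * y)) (- x)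
     = conv (\<lambda>y. 2 * (- a) / g * app p y - r * g / 2 * app q y) (\<lambda>y. sinh (g * y)) x"
    unfolding conv_minus using assms by (simp add: conv_def interval_lebesgue_integral_uminus[symmetric])
  have 2: "conv (\<lambda>y. r * app p y - a * app q y) (\<lambda>y. cosh (g * y)) (- x)
     = conv (\<lambda>y. r * app p y - (- a) * app q y) (\<lambda>y. cosh (g * y)) x"
    unfolding conv_minus using assms
    by (simp add: conv_def interval_lebesgue_integral_uminus[symmetric] algebra_simps)
  show ?thesis unfolding half_def 1 2 using assms by simp
qed

lemma half_mem:
  assumes g: "g > 0"
    and s: "\<And>x. app f (- x) = app f x" "\<And>x. app p (- x) = - app p x" "\<And>x. app q (- x) = app q x"
  shows "app (Lim_cont (half f p q g a r)) = half f p q g a r"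
proof (rule Lim_cont_inverse, intro CollectI conjI)
  have eq: "half f p q g a r x = half f p q g (- a) r (- x)" for x
    using half_minus[OF s, of g a r "- x"] by simp
  have "continuous_on {..0} (\<lambda>x. half f p q g (- a) r (- x))"
    by (rule continuous_on_compose2[OF half_continuous[OF g]]) (auto intro!: continuous_intros)
  then have "continuous_on {..0} (half f p q g a r)" by (simp flip: eq)
  then have "continuous_on ({..0} \<union> {0..}) (half f p q g a r)"
    by (intro continuous_on_closed_Un half_continuous[OF g]) auto
  moreover have "{..0} \<union> {0..} = (UNIV :: real set)" by auto
  ultimately show "continuous_on UNIV (half f p q g a r)" by simp
  show "\<exists>l. (half f p q g a r \<longlongrightarrow> l) at_top" by (rule half_limit[OF g])
  obtain l where "(half f p q g (- a) r \<longlongrightarrow> l) at_top" using half_limit[OF g] by blast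
  then have "((\<lambda>x. half f p q g (- a) r (- x)) \<longlongrightarrow> l) at_bot"
    by (rule filterlim_compose[OF _ filterlim_uminus_at_top_at_bot])
  then show "\<exists>l. (half f p q g a r \<longlongrightarrow> l) at_bot" by (auto simp flip: eq)
qed

lemma gam_pos:
  assumes "\<alpha> + \<beta> > 0" shows "gam \<alpha> \<beta> > 0"
proof -
  have "\<alpha>\<^sup>2 + \<beta>\<^sup>2 > 0" using assms by (auto simp: sum_power2_gt_zero_iff)
  then show ?thesis unfolding gam_def by (intro real_sqrt_gt_zero mult_pos_pos) auto
qed

lemma app_P:
  assumes "\<alpha> + \<beta> > 0"
  shows "app (fst (P \<alpha> \<beta> F)) = P_fst \<alpha> \<beta> F" "app (snd (P \<alpha> \<beta> F)) = P_snd \<alpha> \<beta> F"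
proof -
  have 1: "P_fst \<alpha> \<beta> F = half (even_part (fst F)) (k1 \<alpha> \<beta> F) (k2 F) (gam \<alpha> \<beta>) \<alpha> 1"
    by (auto simp: P_fst_def half_def cconst_def Let_def)
  have 2: "P_snd \<alpha> \<beta> F = half (even_part (snd F)) (k1 \<alpha> \<beta> F) (k2 F) (gam \<alpha> \<beta>) \<beta> (- 1)"
  proof
    fix x
    have "conv (\<lambda>y. - app (k1 \<alpha> \<beta> F) y - \<beta> * app (k2 F) y) (\<lambda>y. cosh (gam \<alpha> \<beta> * y)) x
      = - conv (\<lambda>y. app (k1 \<alpha> \<beta> F) y + \<beta> * app (k2 F) y) (\<lambda>y. cosh (gam \<alpha> \<beta> * y)) x"
      unfolding conv_def interval_lebesgue_integral_uminus[symmetric]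
      by (rule interval_integral_cong) (simp add: algebra_simps)
    then show "P_snd \<alpha> \<beta> F x = half (even_part (snd F)) (k1 \<alpha> \<beta> F) (k2 F) (gam \<alpha> \<beta>) \<beta> (- 1) x"
      by (simp add: P_snd_def half_def cconst_def Let_def)
  qed
  show "app (fst (P \<alpha> \<beta> F)) = P_fst \<alpha> \<beta> F" "app (snd (P \<alpha> \<beta> F)) = P_snd \<alpha> \<beta> F"
    unfolding P_def fst_conv snd_conv 1 2
    by (rule half_mem[OF gam_pos[OF assms]]; simp add: even_part_def odd_part_def k1_def k2_def algebra_simps)+
qed

lemma glue_continuous:
  fixes u v h :: "real \<Rightarrow> real"
  assumes "continuous_on {..<0} u" "continuous_on {0<..} v" "(u \<longlongrightarrow> c) (at_left 0)" "(v \<longlongrightarrow> c) (at_right 0)"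
  shows "continuous_on UNIV (\<lambda>x. if x < 0 then u x else if x = 0 then c else v x)" (is "continuous_on UNIV ?h")
proof -
  have "isCont ?h x" for x
  proof (cases x "0 :: real" rule: linorder_cases)
    case less
    then have "isCont u x" using assms(1) by (simp add: continuous_on_eq_continuous_at)
    moreover have "eventually (\<lambda>y. u y = ?h y) (nhds x)"
      using less by (intro eventually_mono[OF eventually_nhds_in_open[of "{..<0}" x]]) auto
    ultimately show ?thesis using isCont_cong by fastforce
  next
    case greater
    then have "isCont v x" using assms(2) by (simp add: continuous_on_eq_continuous_at)
    moreover have "eventually (\<lambda>y. v y = ?h y) (nhds x)"
      using greater by (intro eventually_mono[OF eventually_nhds_in_open[of "{0<..}" x]]) auto
    ultimately show ?thesis using isCont_cong by fastforce
  next
    case equal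
    have "(?h \<longlongrightarrow> c) (at_left 0)"
      by (rule Lim_transform_eventually[OF assms(3)]) (auto simp: eventually_at_filter)
    moreover have "(?h \<longlongrightarrow> c) (at_right 0)"
      by (rule Lim_transform_eventually[OF assms(4)]) (auto simp: eventually_at_filter)
    ultimately show ?thesis using equal by (simp add: isCont_def filterlim_split_at)
  qed
  then show ?thesis by (simp add: continuous_at_imp_continuous_on)
qed

lemma app_E_weks:
  assumes f: "f \<in> C_ov" and ab: "\<alpha> + \<beta> > 0"
  shows "app (fst (E_weks \<alpha> \<beta> f)) = E_left \<alpha> \<beta> f" "app (snd (E_weks \<alpha> \<beta> f)) = E_right \<alpha> \<beta> f"
proof -
  obtain a b l where c: "continuous_on (- {0}) f" and a: "(f \<longlongrightarrow> a) at_bot" and b: "(f \<longlongrightarrow> b) at_top"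
    and r: "(f \<longlongrightarrow> l) (at_right 0)" and lf: "(f \<longlongrightarrow> - l) (at_left 0)"
    using f unfolding C_ov_def by blast
  have Lims: "Lim (at_left 0) f = - l" "Lim (at_right 0) f = l"
    using lf r by (auto intro!: tendsto_Lim)
  have r': "((\<lambda>x. f (- x)) \<longlongrightarrow> l) (at_left 0)" and lf': "((\<lambda>x. f (- x)) \<longlongrightarrow> - l) (at_right 0)"
    using r lf by (simp_all add: filterlim_at_left_to_right[of _ _ 0] )
  have a': "((\<lambda>x. f (- x)) \<longlongrightarrow> a) at_top" and b': "((\<lambda>x. f (- x)) \<longlongrightarrow> b) at_bot"
    using filterlim_compose[OF a filterlim_uminus_at_bot_at_top]
      filterlim_compose[OF b filterlim_uminus_at_top_at_bot] by auto
  have c1: "continuous_on {..<0} f" "continuous_on {0<..} f"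
    by (auto intro: continuous_on_subset[OF c])
  have c2: "continuous_on {..<0} (\<lambda>x. f (- x))" "continuous_on {0<..} (\<lambda>x. f (- x))"
    by (auto intro!: continuous_on_compose2[OF c] continuous_intros)
  have "(\<alpha> - \<beta>) / (\<alpha> + \<beta>) * - l - 2 * \<beta> / (\<alpha> + \<beta>) * l = - l"
    using ab by (simp add: divide_simps) (simp add: algebra_simps)
  then have vl: "((\<lambda>x. (\<alpha> - \<beta>) / (\<alpha> + \<beta>) * f (- x) - 2 * \<beta> / (\<alpha> + \<beta>) * f x) \<longlongrightarrow> - l) (at_right 0)"
    using tendsto_diff[OF tendsto_mult_left[OF lf', of "(\<alpha> - \<beta>) / (\<alpha> + \<beta>)"] tendsto_mult_left[OF r, of "2 * \<beta> / (\<alpha> + \<beta>)"]]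
    by simp
  have "- (2 * \<alpha> / (\<alpha> + \<beta>)) * - l + (\<beta> - \<alpha>) / (\<alpha> + \<beta>) * l = l"
    using ab by (simp add: divide_simps) (simp add: algebra_simps)
  then have vr: "((\<lambda>x. - (2 * \<alpha> / (\<alpha> + \<beta>)) * f x + (\<beta> - \<alpha>) / (\<alpha> + \<beta>) * f (- x)) \<longlongrightarrow> l) (at_left 0)"
    using tendsto_add[OF tendsto_mult_left[OF lf, of "- (2 * \<alpha> / (\<alpha> + \<beta>))"] tendsto_mult_left[OF r', of "(\<beta> - \<alpha>) / (\<alpha> + \<beta>)"]]
    by simp
  show "app (fst (E_weks \<alpha> \<beta> f)) = E_left \<alpha> \<beta> f"
    unfolding E_weks_def fst_conv
  proof (rule Lim_cont_inverse, intro CollectI conjI exI)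
    show "continuous_on UNIV (E_left \<alpha> \<beta> f)"
      unfolding E_left_def[abs_def] Lims
      by (rule glue_continuous[OF _ _ lf vl]) (intro continuous_intros c1 c2)+
    show "(E_left \<alpha> \<beta> f \<longlongrightarrow> a) at_bot"
      by (rule Lim_transform_eventually[OF a])
         (rule eventually_mono[OF eventually_gt_at_bot[of 0]], simp add: E_left_def)
    show "(E_left \<alpha> \<beta> f \<longlongrightarrow> (\<alpha> - \<beta>) / (\<alpha> + \<beta>) * a - 2 * \<beta> / (\<alpha> + \<beta>) * b) at_top"
      by (rule Lim_transform_eventually[OF tendsto_diff[OF tendsto_mult_left[OF a'] tendsto_mult_left[OF b]]])
         (rule eventually_mono[OF eventually_gt_at_top[of 0]], simp add: E_left_def)
  qed
  show "app (snd (E_weks \<alpha> \<beta> f)) = E_right \<alpha> \<beta> f"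
    unfolding E_weks_def snd_conv
  proof (rule Lim_cont_inverse, intro CollectI conjI exI)
    show "continuous_on UNIV (E_right \<alpha> \<beta> f)"
      unfolding E_right_def[abs_def] Lims
      by (rule glue_continuous[OF _ _ vr r]) (intro continuous_intros c1 c2)+
    show "(E_right \<alpha> \<beta> f \<longlongrightarrow> b) at_top"
      by (rule Lim_transform_eventually[OF b])
         (rule eventually_mono[OF eventually_gt_at_top[of 0]], simp add: E_right_def)
    show "(E_right \<alpha> \<beta> f \<longlongrightarrow> - (2 * \<alpha> / (\<alpha> + \<beta>)) * a + (\<beta> - \<alpha>) / (\<alpha> + \<beta>) * b) at_bot"
      by (rule Lim_transform_eventually[OF tendsto_add[OF tendsto_mult_left[OF a] tendsto_mult_left[OF b']]])
         (rule eventually_mono[OF eventually_gt_at_bot[of 0]], simp add: E_right_def)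
  qed
qed

end

theory Submission
  imports Defs
begin

text \<open>Writing \<open>R\<^sub>s k x = (\<integral>v\<ge>0. exp (- s v) k (x + v))\<close>, the oddness of \<open>k\<^sub>1\<close> and the evenness of \<open>k\<^sub>2\<close>
  turn the convolution formula for \<open>P\<close> into a combination of \<open>R\<^sub>\<gamma> k\<^sub>i x\<close> and \<open>R\<^sub>\<gamma> k\<^sub>i (- x)\<close>: the
  exponentially growing terms and the constant \<open>c\<close> are absorbed exactly. Since the elements of the
  space are uniformly continuous, \<open>s R\<^sub>s k\<close> tends to \<open>k\<close> uniformly as \<open>s\<close> tends to infinity, and (a)
  follows by substituting \<open>s = n \<gamma>\<close>. Parts (b) and (c) are pointwise linear algebra.\<close>

section \<open>Uniform convergence in \<open>lim_cont\<close>\<close>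

lemma norm_lim_cont_least: "(\<And>x. \<bar>app h x\<bar> \<le> B) \<Longrightarrow> norm h \<le> B"
  unfolding norm_lim_cont_def by (intro cSUP_least) auto

lemma tendsto_lim_contI:
  assumes "uniform_limit UNIV (\<lambda>n. app (h n)) (app l) G"
  shows "(h \<longlongrightarrow> l) G"
proof (rule tendstoI)
  fix e :: real assume "e > 0"
  \<comment> \<open>Half of \<open>e\<close>, because passing to the supremum over \<open>x\<close>
    preserves only a weak inequality.\<close>
  then have "eventually (\<lambda>n. \<forall>x\<in>UNIV. dist (app (h n) x) (app l x) < e / 2) G"
    using assms[unfolded uniform_limit_iff, rule_format, of "e / 2"] by simp
  then show "eventually (\<lambda>n. dist (h n) l < e) G"
  proof eventually_elim
    case (elim n)
    have "norm (h n - l) \<le> e / 2"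
      by (rule norm_lim_cont_least) (use elim in \<open>auto simp: dist_real_def intro: less_imp_le\<close>)
    then show ?case using \<open>e > 0\<close> by (simp add: dist_lim_cont_def)
  qed
qed

text \<open>Near each end the values stay within \<open>e / 2\<close> of the limit there, and what
  remains is a compact interval. Widening it by 1 and capping distances at 1 puts any two close
  points into a common one of the three regions.\<close>

lemma uniformly_continuous_app: "uniformly_continuous_on UNIV (app k)"
  unfolding uniformly_continuous_on_def
proof (intro allI impI)
  fix e :: real assume e: "e > 0"
  obtain l m where l: "(app k \<longlongrightarrow> l) at_bot" and m: "(app k \<longlongrightarrow> m) at_top"
    using app_limits by metis
  have "eventually (\<lambda>x. dist (app k x) l < e / 2) at_bot" "eventually (\<lambda>x. dist (app k x) m < e / 2) at_top"
    using tendstoD[OF l, of "e / 2"] tendstoD[OF m, of "e / 2"] e by simp_all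
  then obtain a b where a: "\<And>x. x \<le> a \<Longrightarrow> dist (app k x) l < e / 2"
    and b: "\<And>x. x \<ge> b \<Longrightarrow> dist (app k x) m < e / 2"
    by (auto simp: eventually_at_bot_linorder eventually_at_top_linorder)
  have "uniformly_continuous_on {a - 1..b + 1} (app k)"
    by (intro compact_uniformly_continuous continuous_on_subset[OF continuous_app_UNIV]) auto
  then obtain d where d: "d > 0"
    "\<And>x y. x \<in> {a - 1..b + 1} \<Longrightarrow> y \<in> {a - 1..b + 1} \<Longrightarrow> dist y x < d \<Longrightarrow> dist (app k y) (app k x) < e"
    unfolding uniformly_continuous_on_def using e by metis
  have "dist (app k y) (app k x) < e" if xy: "dist y x < min d 1" for x y
  proof -
    \<comment> \<open>Unless both points are at most \<open>a\<close>, both exceed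
      \<open>a - 1\<close>; unless both are at least \<open>b\<close>, both are below
      \<open>b + 1\<close>. This holds whatever the order of \<open>a\<close> and
      \<open>b\<close>.\<close>
    consider "x \<le> a \<and> y \<le> a" | "b \<le> x \<and> b \<le> y" | "x \<in> {a - 1..b + 1} \<and> y \<in> {a - 1..b + 1}"
      using xy by (auto simp: dist_real_def) linarith+
    then show ?thesis
    proof cases
      case 1
      then show ?thesis using a by (metis dist_triangle_half_l)
    next
      case 2
      then show ?thesis using b by (metis dist_triangle_half_l)
    next
      case 3
      then show ?thesis using d(2)[of x y] xy by auto
    qed
  qed
  then show "\<exists>d>0. \<forall>x\<in>UNIV. \<forall>x'\<in>UNIV. dist x' x < d \<longrightarrow> dist (app k x') (app k x) < e"
    using d(1) by (intro exI[of _ "min d 1"]) auto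
qed

section \<open>Laplace transforms of translates\<close>

text \<open>For \<open>s > 0\<close> this is the resolvent at \<open>s\<close> of the generator d/dx
  of the translation semigroup, evaluated at \<open>x\<close>; it is the \<open>R\<close> of the
  introduction.\<close>

definition resolv :: "real \<Rightarrow> lim_cont \<Rightarrow> real \<Rightarrow> real" where
  "resolv s k x = laplace (\<lambda>v. app k (x + v)) s"

lemma resolv_scaleR: "resolv s (c *\<^sub>R k) x = c * resolv s k x"
  by (simp add: resolv_def laplace_def mult.left_commute[of _ c])

lemma integral_exp_atLeast: "s > 0 \<Longrightarrow> (LBINT v:{0..}. exp (- s * v)) = 1 / (s::real)"
  using set_borel_integral_eq_integral(2)[OF exp_integrable, of s]
    integral_unique[OF has_integral_exp_minus_to_infinity, of s 0] by simp

text \<open>Cut the integral at \<open>x\<close>; the substitution \<open>u = x + v\<close> in the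
  tail releases the factor \<open>exp (- s * x)\<close>.\<close>

lemma laplace_split:
  assumes f: "continuous_on UNIV f" and B: "\<And>x. \<bar>f x\<bar> \<le> B" and s: "s > 0" and x: "x \<ge> 0"
  shows "laplace f s = expint s f x + exp (- s * x) * laplace (\<lambda>v. f (x + v)) s"
proof -
  have c: "continuous_on {0..x} (\<lambda>u. exp (- s * u) * f u)"
    by (intro continuous_intros continuous_on_subset[OF f]) auto
  have I: "set_integrable lborel {0..} (\<lambda>x. exp (- s * x) * f x)"
    by (rule laplace_integrable[OF f B s])
  have 1: "expint s f x = (LBINT u:{0..x}. exp (- s * u) * f u)"
    unfolding expint_def
    by (rule set_borel_integral_eq_integral(2)[OF borel_integrable_atLeastAtMost'[OF c], symmetric])
  have "{0..} = {0..x} \<union> {x<..}" using x by auto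
  then have 2: "laplace f s = (LBINT u:{0..x}. exp (- s * u) * f u) + (LBINT u:{x<..}. exp (- s * u) * f u)"
    unfolding laplace_def using x
    by (simp only:) (intro set_integral_Un set_integrable_subset[OF I]; force)
  \<comment> \<open>The open tail made the splitting disjoint; adding the null set
    \<open>{x}\<close> gives the set that \<open>u = x + v\<close> pulls back to
    \<open>{0..}\<close>.\<close>
  have "(LBINT u:{x<..}. exp (- s * u) * f u) = (LBINT u:{x..}. exp (- s * u) * f u)"
    by (rule set_integral_discrete_difference[where X = "{x}"]) auto
  also have "\<dots> = (\<integral>u. indicator {x..} u * (exp (- s * u) * f u) \<partial>lborel)"
    by (simp add: set_lebesgue_integral_def)
  also have "\<dots> = (\<integral>v. indicator {x..} (x + v) * (exp (- s * (x + v)) * f (x + v)) \<partial>lborel)"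
    by (subst lborel_integral_real_affine[where c = 1 and t = x]) auto
  also have "\<dots> = (\<integral>v. exp (- s * x) * (indicator {0..} v * (exp (- s * v) * f (x + v))) \<partial>lborel)"
    by (rule Bochner_Integration.integral_cong)
       (auto simp: indicator_def algebra_simps exp_diff exp_minus field_simps exp_add)
  also have "\<dots> = exp (- s * x) * laplace (\<lambda>v. f (x + v)) s"
    by (simp add: laplace_def set_lebesgue_integral_def)
  finally show ?thesis using 1 2 by simp
qed

text \<open>This evaluates the \<open>H\<close> terms of \<open>half_eq\<close>: the growing factor
  multiplies a Laplace tail that carries exactly the inverse factor.\<close>

lemma resolv_nonneg:
  assumes "s > 0" "x \<ge> 0"
  shows "exp (s * x) * (laplace (app k) s - expint s (app k) x) = resolv s k x"
  using laplace_split[OF continuous_app_UNIV app_bounded assms, of k]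
  by (simp add: resolv_def exp_minus field_simps)

text \<open>This evaluates the \<open>M\<close> terms of \<open>half_eq\<close> for functions with a
  parity. The left side is the part over \<open>{0..x}\<close> of the Laplace integral of
  \<open>k\<close> translated by \<open>x\<close>; the missing tail starts at the value of
  \<open>k\<close> at 0.\<close>

lemma resolv_nonpos:
  assumes s: "s > 0" and x: "x \<ge> 0"
  shows "exp (- s * x) * expint (- s) (app (reflect k)) x = resolv s k (- x) - exp (- s * x) * laplace (app k) s"
proof -
  \<comment> \<open>With this translate, \<open>laplace f s\<close> is
    \<open>resolv s k (- x)\<close>, and the tail beyond \<open>x\<close> involves \<open>k\<close>
    itself.\<close>
  define f where "f = (\<lambda>u. app k (u - x))"
  have f: "continuous_on UNIV f" unfolding f_def by (intro continuous_intros)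
  have c: "continuous_on {0..x} (\<lambda>u. exp (- s * u) * f u)"
    by (intro continuous_intros continuous_on_subset[OF f]) auto
  have "exp (- s * x) * expint (- s) (app (reflect k)) x = conv (app (reflect k)) (\<lambda>y. exp (- s * y)) x"
    by (rule conv_exp[OF x continuous_app_UNIV, symmetric])
  also have "\<dots> = (LBINT u:{0..x}. exp (- s * u) * f u)"
    by (simp add: conv_eq[OF x] f_def mult.commute)
  also have "\<dots> = expint s f x"
    unfolding expint_def
    by (rule set_borel_integral_eq_integral(2)[OF borel_integrable_atLeastAtMost'[OF c]])
  finally show ?thesis
    using laplace_split[OF f _ s x, of "norm k"] app_bounded[of k] by (simp add: f_def resolv_def)
qed

text \<open>\<open>s * resolv s k x\<close> averages \<open>k\<close> to the right of
  \<open>x\<close> against the probability density \<open>s * exp (- s * v)\<close>, whose mass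
  beyond \<open>d\<close> is exponentially small. The point \<open>x\<close> enters the bound only
  through \<open>e\<close>.\<close>

lemma resolv_error:
  assumes s: "s > 0" and d: "d > 0"
    and near: "\<And>v. \<bar>v\<bar> < d \<Longrightarrow> \<bar>app k (x + v) - app k x\<bar> \<le> e" and e: "e \<ge> 0"
  shows "\<bar>s * resolv s k x - app k x\<bar> \<le> e + 4 * norm k * exp (- s * d / 2)"
proof -
  have I1: "set_integrable lborel {0..} (\<lambda>v. exp (- s * v) * app k (x + v))"
    by (rule laplace_integrable[OF _ app_bounded s]) (intro continuous_intros)
  have I2: "set_integrable lborel {0..} (\<lambda>v. exp (- s * v) * app k x)"
    using exp_integrable[OF s] by simp
  have J1: "set_integrable lborel {0..} (\<lambda>v. e * exp (- s * v))"
    using exp_integrable[OF s] by simp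
  have J2: "set_integrable lborel {0..} (\<lambda>v. (2 * norm k * exp (- s * d / 2)) * exp (- (s / 2) * v))"
    using exp_integrable[of "s / 2"] s by (intro set_integrable_mult_right) auto
  have eq: "resolv s k x - app k x / s = (LBINT v:{0..}. exp (- s * v) * app k (x + v) - exp (- s * v) * app k x)"
    using I1 I2 integral_exp_atLeast[OF s] by (subst set_integral_diff) (auto simp: resolv_def laplace_def)
  \<comment> \<open>The integrand is at most \<open>2 norm k exp (- s v)\<close> for \<open>v \<ge> d\<close>, and there
    \<open>1 \<le> exp (s (v - d) / 2)\<close>; this avoids splitting the integral at \<open>d\<close>.\<close>
  have bound: "\<bar>exp (- s * v) * app k (x + v) - exp (- s * v) * app k x\<bar>
      \<le> e * exp (- s * v) + (2 * norm k * exp (- s * d / 2)) * exp (- (s / 2) * v)" if v: "v \<ge> 0" for v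
  proof -
    have E: "exp (- s * d / 2) * exp (- (s / 2) * v) = exp (- s * v) * exp (s * (v - d) / 2)"
      unfolding exp_add[symmetric] by (rule arg_cong[where f = exp]) (simp add: field_simps)
    have "\<bar>app k (x + v) - app k x\<bar> \<le> e + 2 * norm k * exp (s * (v - d) / 2)"
    proof (cases "v < d")
      case True
      then show ?thesis using near[of v] v by (simp add: add_increasing2)
    next
      case False
      then have "1 \<le> exp (s * (v - d) / 2)" using s by simp
      then have "2 * norm k * 1 \<le> 2 * norm k * exp (s * (v - d) / 2)" by (intro mult_left_mono) auto
      then show ?thesis using app_bounded[of k x] app_bounded[of k "x + v"] e by linarith
    qed
    then have "exp (- s * v) * \<bar>app k (x + v) - app k x\<bar>
        \<le> exp (- s * v) * (e + 2 * norm k * exp (s * (v - d) / 2))"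
      by (intro mult_left_mono) auto
    also have "\<dots> = e * exp (- s * v) + 2 * norm k * (exp (- s * v) * exp (s * (v - d) / 2))"
      by (simp add: algebra_simps)
    also have "\<dots> = e * exp (- s * v) + (2 * norm k * exp (- s * d / 2)) * exp (- (s / 2) * v)"
      unfolding E[symmetric] by simp
    finally show ?thesis by (simp add: abs_mult flip: right_diff_distrib)
  qed
  have "norm (LBINT v:{0..}. exp (- s * v) * app k (x + v) - exp (- s * v) * app k x)
      \<le> (LBINT v:{0..}. e * exp (- s * v) + (2 * norm k * exp (- s * d / 2)) * exp (- (s / 2) * v))"
    unfolding set_lebesgue_integral_def
  proof (rule Bochner_Integration.integral_norm_bound_integral)
    show "integrable lborel (\<lambda>v. indicator {0..} v *\<^sub>R (exp (- s * v) * app k (x + v) - exp (- s * v) * app k x))"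
      using set_integral_diff(1)[OF I1 I2] by (simp add: set_integrable_def)
    show "integrable lborel (\<lambda>v. indicator {0..} v *\<^sub>R (e * exp (- s * v) + (2 * norm k * exp (- s * d / 2)) * exp (- (s / 2) * v)))"
      using set_integral_add(1)[OF J1 J2] by (simp add: set_integrable_def)
  qed (use bound in \<open>auto simp: indicator_def\<close>)
  \<comment> \<open>Integrating at the halved rate \<open>s / 2\<close> costs a factor 2, which
    makes the final constant \<open>4 * norm k\<close>.\<close>
  also have "\<dots> = e / s + (2 * norm k * exp (- s * d / 2)) * (2 / s)"
    using J1 J2 integral_exp_atLeast[OF s] integral_exp_atLeast[of "s / 2"] s
    by (subst set_integral_add) auto
  finally have "\<bar>resolv s k x - app k x / s\<bar> \<le> e / s + (2 * norm k * exp (- s * d / 2)) * (2 / s)"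
    unfolding eq by simp
  then have "s * \<bar>resolv s k x - app k x / s\<bar> \<le> s * (e / s + (2 * norm k * exp (- s * d / 2)) * (2 / s))"
    using s by (intro mult_left_mono) auto
  also have "s * \<bar>resolv s k x - app k x / s\<bar> = \<bar>s * (resolv s k x - app k x / s)\<bar>"
    using s by (simp add: abs_mult)
  finally show ?thesis using s by (simp add: algebra_simps)
qed

text \<open>Uniform continuity supplies one \<open>d\<close> for all \<open>x\<close>, so the
  estimate of \<open>resolv_error\<close> is uniform; then \<open>s\<close> is taken large for this
  fixed \<open>d\<close>.\<close>

lemma uniform_limit_resolv: "uniform_limit UNIV (\<lambda>s x. s * resolv s k x) (app k) at_top"
  unfolding uniform_limit_iff
proof (intro allI impI)
  fix e :: real assume e: "e > 0"
  obtain d where d: "d > 0" "\<And>x y. dist y x < d \<Longrightarrow> dist (app k y) (app k x) < e / 2"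
    using uniformly_continuous_app[of k] e unfolding uniformly_continuous_on_def
    by (metis UNIV_I half_gt_zero)
  have "((\<lambda>s. 4 * norm k * exp (- s * d / 2)) \<longlongrightarrow> 4 * norm k * 0) at_top"
  proof (intro tendsto_intros filterlim_compose[OF exp_at_bot])
    have "filterlim (\<lambda>s. (- d / 2) * s) at_bot at_top"
      using d(1) by (intro filterlim_tendsto_neg_mult_at_bot[OF tendsto_const]) (auto intro: filterlim_ident)
    then show "filterlim (\<lambda>s. - s * d / 2) at_bot at_top" by (simp add: mult.commute)
  qed
  then have "eventually (\<lambda>s. 4 * norm k * exp (- s * d / 2) < e / 2) at_top"
    using e by (intro order_tendstoD(2)[of _ "4 * norm k * 0"]) auto
  then show "eventually (\<lambda>s. \<forall>x\<in>UNIV. dist (s * resolv s k x) (app k x) < e) at_top"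
    using eventually_gt_at_top[of 0]
  proof eventually_elim
    case (elim s)
    have "\<bar>s * resolv s k x - app k x\<bar> < e" for x
    proof -
      have "\<bar>app k (x + v) - app k x\<bar> \<le> e / 2" if "\<bar>v\<bar> < d" for v
        using d(2)[of "x + v" x] that by (simp add: dist_real_def)
      then show ?thesis using resolv_error[OF elim(2) d(1), of k x "e / 2"] elim(1) e by force
    qed
    then show ?case by (simp add: dist_real_def)
  qed
qed

section \<open>The limit of \<open>P\<close>\<close>

text \<open>The terms \<open>exp (- g * x) * laplace _ g\<close> left over by
  \<open>resolv_nonpos\<close> cancel against the decaying term of \<open>half_eq\<close>; the
  constant \<open>c\<close> in \<open>P\<close> has precisely the value that achieves this.\<close>

lemma half_resolv_nonneg:
  assumes g: "g > 0" and x: "x \<ge> 0" and p: "reflect p = - p" and q: "reflect q = q"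
  shows "half f p q g a r x = app f x
     + (a / g - r / 2) * (resolv g p x + g / 2 * resolv g q x)
     - (a / g + r / 2) * (resolv g p (- x) + g / 2 * resolv g q (- x))"
proof -
  have "expint (- g) (app (- p)) x = - expint (- g) (app p) x"
    by (simp add: expint_def)
  then have Mp: "exp (- g * x) * expint (- g) (app p) x = - resolv g p (- x) + exp (- g * x) * laplace (app p) g"
    using resolv_nonpos[OF g x, of p] by (simp add: p)
  have Mq: "exp (- g * x) * expint (- g) (app q) x = resolv g q (- x) - exp (- g * x) * laplace (app q) g"
    using resolv_nonpos[OF g x, of q] by (simp add: q)
  show ?thesis
    unfolding half_eq[OF g x] resolv_nonneg[OF g x] Mp Mq using g by (simp add: field_simps)
qed

text \<open>By \<open>half_minus\<close>, reflecting \<open>x\<close> amounts to changing the sign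
  of \<open>a\<close>, and the right side is invariant under both changes together.\<close>

lemma half_resolv:
  assumes g: "g > 0" and f: "reflect f = f" and p: "reflect p = - p" and q: "reflect q = q"
  shows "half f p q g a r x = app f x
     + (a / g - r / 2) * (resolv g p x + g / 2 * resolv g q x)
     - (a / g + r / 2) * (resolv g p (- x) + g / 2 * resolv g q (- x))"
proof (cases "x \<ge> 0")
  case True
  then show ?thesis by (rule half_resolv_nonneg[OF g _ p q])
next
  case False
  have "app f (- y) = app f y" "app p (- y) = - app p y" "app q (- y) = app q y" for y
    using arg_cong[OF f, of "\<lambda>h. app h y"] arg_cong[OF p, of "\<lambda>h. app h y"]
      arg_cong[OF q, of "\<lambda>h. app h y"] by simp_all
  then have "half f p q g a r (- (- x)) = half f p q g (- a) r (- x)" "app f (- x) = app f x"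
    using half_minus[of f p q g a r "- x"] by auto
  then have "half f p q g a r x = app f x
     + (- a / g - r / 2) * (resolv g p (- x) + g / 2 * resolv g q (- x))
     - (- a / g + r / 2) * (resolv g p x + g / 2 * resolv g q x)"
    using half_resolv_nonneg[OF g _ p q, of "- x" f "- a" r] False by simp
  \<comment> \<open>The sign change of \<open>a\<close> exchanges the two coefficients up to sign,
    just as the reflection exchanges the two resolvent values.\<close>
  moreover have "- a / g - r / 2 = - (a / g + r / 2)" "- a / g + r / 2 = - (a / g - r / 2)"
    by simp_all
  ultimately show ?thesis by (simp only: mult_minus_left)
qed

text \<open>Under this scaling \<open>a / g\<close> stays fixed, and with \<open>s = n g\<close> the
  brackets become \<open>s R p / g + s R q / 2\<close>. In the limit the parities of
  \<open>p\<close> and \<open>q\<close> collapse the values at \<open>x\<close> and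
  \<open>- x\<close> to the stated coefficients.\<close>

lemma uniform_limit_half:
  assumes g: "g > 0" and f: "reflect f = f" and p: "reflect p = - p" and q: "reflect q = q"
  shows "uniform_limit UNIV (\<lambda>n. half f (real n *\<^sub>R p) q (real n * g) (real n * a) r)
           (app (f + (2 * a / g\<^sup>2) *\<^sub>R p - (r / 2) *\<^sub>R q)) sequentially"
proof -
  have lim: "filterlim (\<lambda>n. real n * g) at_top sequentially"
    using g by (intro filterlim_at_top_mult_tendsto_pos[OF tendsto_const _ filterlim_real_sequentially]) auto
  have U: "uniform_limit UNIV (\<lambda>n x. real n * g * resolv (real n * g) k x) (app k) sequentially" for k
    by (rule filterlim_compose[OF uniform_limit_resolv lim])
  have U': "uniform_limit UNIV (\<lambda>n x. real n * g * resolv (real n * g) k (- x)) (\<lambda>x. app k (- x)) sequentially" for k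
    using uniform_limit_compose'[OF U[of k], of uminus UNIV] by simp
  have ap: "app p (- x) = - app p x" "app q (- x) = app q x" for x
    using arg_cong[OF p, of "\<lambda>h. app h x"] arg_cong[OF q, of "\<lambda>h. app h x"] by simp_all
  let ?S = "\<lambda>n k x. real n * g * resolv (real n * g) k x"
  have "uniform_limit UNIV (\<lambda>n x. app f x
      + (a / g - r / 2) * (1 / g * ?S n p x + 1 / 2 * ?S n q x)
      - (a / g + r / 2) * (1 / g * ?S n p (- x) + 1 / 2 * ?S n q (- x)))
    (\<lambda>x. app f x + (a / g - r / 2) * (1 / g * app p x + 1 / 2 * app q x)
      - (a / g + r / 2) * (1 / g * app p (- x) + 1 / 2 * app q (- x))) sequentially"
    by (intro uniform_limit_intros bounded_linear.uniform_limit[OF bounded_linear_mult_right] U U')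
  also have "(\<lambda>x. app f x + (a / g - r / 2) * (1 / g * app p x + 1 / 2 * app q x)
      - (a / g + r / 2) * (1 / g * app p (- x) + 1 / 2 * app q (- x)))
    = app (f + (2 * a / g\<^sup>2) *\<^sub>R p - (r / 2) *\<^sub>R q)"
    using g by (auto simp: ap field_simps power2_eq_square)
  finally have lim': "uniform_limit UNIV (\<lambda>n x. app f x
      + (a / g - r / 2) * (1 / g * ?S n p x + 1 / 2 * ?S n q x)
      - (a / g + r / 2) * (1 / g * ?S n p (- x) + 1 / 2 * ?S n q (- x)))
    (app (f + (2 * a / g\<^sup>2) *\<^sub>R p - (r / 2) *\<^sub>R q)) sequentially" .
  have "\<forall>\<^sub>F n in sequentially. \<forall>x\<in>UNIV. app f x
      + (a / g - r / 2) * (1 / g * ?S n p x + 1 / 2 * ?S n q x)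
      - (a / g + r / 2) * (1 / g * ?S n p (- x) + 1 / 2 * ?S n q (- x))
      = half f (real n *\<^sub>R p) q (real n * g) (real n * a) r x"
    \<comment> \<open>For \<open>n = 0\<close> the rate vanishes and \<open>half_resolv\<close> does
      not apply.\<close>
    using eventually_gt_at_top[of 0]
  proof eventually_elim
    case (elim n)
    have np: "reflect (real n *\<^sub>R p) = - (real n *\<^sub>R p)"
      by (simp add: app_inject[symmetric] fun_eq_iff ap)
    show ?case
      using half_resolv[OF _ f np q, of "real n * g" "real n * a" r] elim g
      by (simp add: resolv_scaleR)
  qed
  from uniform_limit_cong[OF this refl] lim' show ?thesis by blast
qed

text \<open>Stated below \<open>Lim_cont\<close> and without positivity, so that it rewrites every
  member of the sequence, including \<open>n = 0\<close>. In the second coordinate the sign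
  \<open>r = - 1\<close> must be moved through the convolution with cosh.\<close>

lemma P_eq_half:
  "P \<alpha> \<beta> F = (Lim_cont (half (even_part (fst F)) (k1 \<alpha> \<beta> F) (k2 F) (gam \<alpha> \<beta>) \<alpha> 1),
              Lim_cont (half (even_part (snd F)) (k1 \<alpha> \<beta> F) (k2 F) (gam \<alpha> \<beta>) \<beta> (- 1)))"
proof -
  have "conv (\<lambda>y. - app (k1 \<alpha> \<beta> F) y - \<beta> * app (k2 F) y) (\<lambda>y. cosh (gam \<alpha> \<beta> * y)) x
      = - conv (\<lambda>y. app (k1 \<alpha> \<beta> F) y + \<beta> * app (k2 F) y) (\<lambda>y. cosh (gam \<alpha> \<beta> * y)) x" for x
    unfolding conv_def interval_lebesgue_integral_uminus[symmetric]
    by (rule interval_integral_cong) (simp add: algebra_simps)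
  then have "P_snd \<alpha> \<beta> F = half (even_part (snd F)) (k1 \<alpha> \<beta> F) (k2 F) (gam \<alpha> \<beta>) \<beta> (- 1)"
    by (auto simp: P_snd_def half_def cconst_def Let_def)
  moreover have "P_fst \<alpha> \<beta> F = half (even_part (fst F)) (k1 \<alpha> \<beta> F) (k2 F) (gam \<alpha> \<beta>) \<alpha> 1"
    by (auto simp: P_fst_def half_def cconst_def Let_def)
  ultimately show ?thesis by (simp add: P_def)
qed

lemma lim_cont_eqI: "(\<And>x. app f x = app g x) \<Longrightarrow> f = g"
  by (metis app_inject ext)

lemma reflect_even_part: "reflect (even_part f) = even_part f"
  and reflect_k1: "reflect (k1 \<alpha> \<beta> F) = - k1 \<alpha> \<beta> F"
  and reflect_k2: "reflect (k2 F) = k2 F"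
  by (rule lim_cont_eqI, simp add: even_part_def odd_part_def k1_def k2_def algebra_simps)+

text \<open>\<open>gam\<close> and \<open>k1\<close> are homogeneous of degree one in (\<alpha>,
  \<beta>) for the factor \<open>real n\<close>, while \<open>k2\<close> does not depend on them;
  this is the scaling of \<open>uniform_limit_half\<close>.\<close>

lemma P_tendsto_P_skew:
  assumes "\<alpha> + \<beta> > 0"
  shows "(\<lambda>n. P (real n * \<alpha>) (real n * \<beta>) F) \<longlonglongrightarrow> P_skew \<alpha> \<beta> F"
proof -
  have g: "gam (real n * \<alpha>) (real n * \<beta>) = real n * gam \<alpha> \<beta>" for n
  proof -
    have "2 * ((real n * \<alpha>)\<^sup>2 + (real n * \<beta>)\<^sup>2) = (real n)\<^sup>2 * (2 * (\<alpha>\<^sup>2 + \<beta>\<^sup>2))"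
      by (simp add: power_mult_distrib algebra_simps)
    then show ?thesis by (simp only: gam_def real_sqrt_mult) simp
  qed
  have k: "k1 (real n * \<alpha>) (real n * \<beta>) F = real n *\<^sub>R k1 \<alpha> \<beta> F" for n
    by (simp add: k1_def scaleR_right_distrib)
  have *: "(\<lambda>n. Lim_cont (half f (real n *\<^sub>R k1 \<alpha> \<beta> F) (k2 F) (real n * gam \<alpha> \<beta>) (real n * a) r))
      \<longlonglongrightarrow> f + (2 * a / (gam \<alpha> \<beta>)\<^sup>2) *\<^sub>R k1 \<alpha> \<beta> F - (r / 2) *\<^sub>R k2 F"
    if f: "reflect f = f" for f a r
  proof (rule tendsto_lim_contI)
    \<comment> \<open>The uniform limit concerns raw functions; for \<open>n > 0\<close> they belong
      to the space, so \<open>Lim_cont\<close> leaves them unchanged.\<close>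
    have "app (Lim_cont (half f (real n *\<^sub>R k1 \<alpha> \<beta> F) (k2 F) (real n * gam \<alpha> \<beta>) (real n * a) r))
        = half f (real n *\<^sub>R k1 \<alpha> \<beta> F) (k2 F) (real n * gam \<alpha> \<beta>) (real n * a) r" if "n > 0" for n
    proof (rule half_mem)
      fix x
      show "app f (- x) = app f x" using arg_cong[OF f, of "\<lambda>h. app h x"] by simp
      show "app (real n *\<^sub>R k1 \<alpha> \<beta> F) (- x) = - app (real n *\<^sub>R k1 \<alpha> \<beta> F) x"
        using arg_cong[OF reflect_k1, of "\<lambda>h. app h x" \<alpha> \<beta> F] by simp
      show "app (k2 F) (- x) = app (k2 F) x" using arg_cong[OF reflect_k2, of "\<lambda>h. app h x" F] by simp
    qed (use that gam_pos[OF assms] in simp)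
    then have "\<forall>\<^sub>F n in sequentially. \<forall>x\<in>UNIV.
        app (Lim_cont (half f (real n *\<^sub>R k1 \<alpha> \<beta> F) (k2 F) (real n * gam \<alpha> \<beta>) (real n * a) r)) x
        = half f (real n *\<^sub>R k1 \<alpha> \<beta> F) (k2 F) (real n * gam \<alpha> \<beta>) (real n * a) r x"
      by (intro eventually_mono[OF eventually_gt_at_top[of 0]]) simp
    then show "uniform_limit UNIV
        (\<lambda>n. app (Lim_cont (half f (real n *\<^sub>R k1 \<alpha> \<beta> F) (k2 F) (real n * gam \<alpha> \<beta>) (real n * a) r)))
        (app (f + (2 * a / (gam \<alpha> \<beta>)\<^sup>2) *\<^sub>R k1 \<alpha> \<beta> F - (r / 2) *\<^sub>R k2 F)) sequentially"
      using uniform_limit_half[OF gam_pos[OF assms] f reflect_k1 reflect_k2, of \<alpha> \<beta> F F a r]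
      by (subst uniform_limit_cong) auto
  qed
  show ?thesis
    unfolding P_eq_half g k P_skew_def
    using tendsto_Pair[OF *[OF reflect_even_part, of "fst F" \<alpha> 1] *[OF reflect_even_part, of "snd F" \<beta> "- 1"]]
    by simp
qed

section \<open>The projection\<close>

lemma bounded_linear_reflect: "bounded_linear reflect"
proof
  show "reflect (f + g) = reflect f + reflect g" "reflect (r *\<^sub>R f) = r *\<^sub>R reflect f" for f g r
    by (auto intro: lim_cont_eqI)
  show "\<exists>K. \<forall>f. norm (reflect f) \<le> norm f * K"
    using norm_lim_cont_least[of "reflect _"] app_bounded by (intro exI[of _ 1]) simp
qed

lemma bounded_linear_Q_weks: "bounded_linear (Q_weks \<alpha> \<beta>)"
proof -
  have "bounded_linear (\<lambda>F. Q_weks \<alpha> \<beta> F)"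
    unfolding Q_weks_def P_skew_def k1_def k2_def even_part_def odd_part_def
    by (intro bounded_linear_sub bounded_linear_add bounded_linear_Pair bounded_linear_const_scaleR
        bounded_linear_compose[OF bounded_linear_reflect] bounded_linear_fst bounded_linear_snd bounded_linear_ident)
  then show ?thesis by simp
qed

lemma app_even_odd_part:
  "app (even_part f) x = (app f x + app f (- x)) / 2" "app (odd_part f) x = (app f x - app f (- x)) / 2"
  by (simp_all add: even_part_def odd_part_def)

text \<open>Turns membership into linear equations between values at \<open>x\<close> and
  \<open>- x\<close>, the form used both for the projection and for the extensions.\<close>

lemma D_weks_iff:
  "(g, h) \<in> D_weks \<alpha> \<beta> \<longleftrightarrow> (\<forall>x. app g x + app g (- x) = - (app h x + app h (- x)) \<and>
     \<alpha> * (app g x - app g (- x)) = - (\<beta> * (app h x - app h (- x))))"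
proof -
  have eq: "u = v \<longleftrightarrow> (\<forall>x. app u x = app v x)" for u v by (auto intro: lim_cont_eqI)
  have half: "u / 2 = - (v / 2) \<longleftrightarrow> u = - v" for u v :: real by auto
  show ?thesis
    unfolding D_weks_def eq mem_Collect_eq prod.case
    by (simp only: app_simps app_even_odd_part times_divide_eq_right half all_conj_distrib)
qed

lemma gam_sq: "(gam \<alpha> \<beta>)\<^sup>2 = 2 * (\<alpha>\<^sup>2 + \<beta>\<^sup>2)"
  by (simp add: gam_def)

text \<open>The even parts of the image are half of \<open>k2\<close> and its negative. On the odd
  parts \<open>Q_weks\<close> subtracts the component along (\<alpha>, \<beta>), leaving a pair
  orthogonal to that vector.\<close>

lemma Q_weks_in_D_weks:
  assumes "\<alpha> + \<beta> > 0"
  shows "Q_weks \<alpha> \<beta> F \<in> D_weks \<alpha> \<beta>"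
proof -
  \<comment> \<open>The coefficient of the orthogonal projection of the pair of odd parts at
    \<open>x\<close> onto (\<alpha>, \<beta>).\<close>
  define t where "t x = app (k1 \<alpha> \<beta> F) x / (\<alpha>\<^sup>2 + \<beta>\<^sup>2)" for x
  have nz: "\<alpha>\<^sup>2 + \<beta>\<^sup>2 \<noteq> 0" using assms by (auto simp: sum_power2_eq_zero_iff)
  have t: "\<alpha> * (app (fst F) x - app (fst F) (- x)) + \<beta> * (app (snd F) x - app (snd F) (- x))
      = 2 * (\<alpha>\<^sup>2 + \<beta>\<^sup>2) * t x" for x
  proof -
    have "(\<alpha>\<^sup>2 + \<beta>\<^sup>2) * t x = app (k1 \<alpha> \<beta> F) x" using nz by (simp add: t_def)
    then have "2 * (\<alpha>\<^sup>2 + \<beta>\<^sup>2) * t x = 2 * app (k1 \<alpha> \<beta> F) x" by (simp only: mult.assoc)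
    then show ?thesis by (simp add: k1_def app_even_odd_part distrib_left)
  qed
  have tm: "t (- x) = - t x" for x
    using arg_cong[OF reflect_k1, of "\<lambda>h. app h x" \<alpha> \<beta> F] by (simp add: t_def)
  have c: "2 * a / (gam \<alpha> \<beta>)\<^sup>2 * app (k1 \<alpha> \<beta> F) x = a * t x" for a x
    by (simp only: gam_sq t_def mult_divide_mult_cancel_left_if) simp
  have q: "app (fst (Q_weks \<alpha> \<beta> F)) x = app (odd_part (fst F)) x - \<alpha> * t x + app (k2 F) x / 2"
    "app (snd (Q_weks \<alpha> \<beta> F)) x = app (odd_part (snd F)) x - \<beta> * t x - app (k2 F) x / 2" for x
    unfolding Q_weks_def P_skew_def minus_prod_def fst_conv snd_conv app_simps c app_even_odd_part
    by (simp_all add: field_simps)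
  have k2m: "app (k2 F) (- x) = app (k2 F) x" for x
    by (simp add: k2_def app_even_odd_part add.commute)
  have even: "app (fst (Q_weks \<alpha> \<beta> F)) x + app (fst (Q_weks \<alpha> \<beta> F)) (- x) = app (k2 F) x"
    "app (snd (Q_weks \<alpha> \<beta> F)) x + app (snd (Q_weks \<alpha> \<beta> F)) (- x) = - app (k2 F) x" for x
    unfolding q tm k2m app_even_odd_part minus_minus by (simp_all add: diff_divide_distrib)
  have odd: "app (fst (Q_weks \<alpha> \<beta> F)) x - app (fst (Q_weks \<alpha> \<beta> F)) (- x)
      = app (fst F) x - app (fst F) (- x) - 2 * (\<alpha> * t x)"
    "app (snd (Q_weks \<alpha> \<beta> F)) x - app (snd (Q_weks \<alpha> \<beta> F)) (- x)
      = app (snd F) x - app (snd F) (- x) - 2 * (\<beta> * t x)" for x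
    unfolding q tm k2m app_even_odd_part minus_minus by (simp_all add: diff_divide_distrib)
  have "\<alpha> * (app (fst F) x - app (fst F) (- x) - 2 * (\<alpha> * t x))
      = - (\<beta> * (app (snd F) x - app (snd F) (- x) - 2 * (\<beta> * t x)))" for x
    using t[of x] by (simp add: algebra_simps power2_eq_square)
  then have "(fst (Q_weks \<alpha> \<beta> F), snd (Q_weks \<alpha> \<beta> F)) \<in> D_weks \<alpha> \<beta>"
    unfolding D_weks_iff even odd by simp
  then show ?thesis by simp
qed

text \<open>On \<open>D_weks\<close> the function \<open>k1\<close> vanishes and half of
  \<open>k2\<close> equals the first even part and minus the second, so both coordinates of
  \<open>P_skew\<close> are 0.\<close>

lemma Q_weks_id_on_D_weks:
  assumes "F \<in> D_weks \<alpha> \<beta>"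
  shows "Q_weks \<alpha> \<beta> F = F"
proof -
  have e: "even_part (fst F) = - even_part (snd F)" and o: "\<alpha> *\<^sub>R odd_part (fst F) = - (\<beta> *\<^sub>R odd_part (snd F))"
    using assms by (auto simp: D_weks_def)
  have "k1 \<alpha> \<beta> F = 0" using o by (simp add: k1_def)
  then have "P_skew \<alpha> \<beta> F = 0"
    by (auto simp: P_skew_def k2_def e zero_prod_def intro: lim_cont_eqI)
  then show ?thesis by (simp add: Q_weks_def)
qed

lemma is_projection_on_Q_weks:
  assumes "\<alpha> + \<beta> > 0"
  shows "is_projection_on (Q_weks \<alpha> \<beta>) (D_weks \<alpha> \<beta>)"
  unfolding is_projection_on_def
proof (intro conjI allI bounded_linear_Q_weks)
  show "Q_weks \<alpha> \<beta> (Q_weks \<alpha> \<beta> F) = Q_weks \<alpha> \<beta> F" for F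
    by (rule Q_weks_id_on_D_weks[OF Q_weks_in_D_weks[OF assms]])
  have "F \<in> range (Q_weks \<alpha> \<beta>)" if "F \<in> D_weks \<alpha> \<beta>" for F
    using Q_weks_id_on_D_weks[OF that] by (metis rangeI)
  then show "range (Q_weks \<alpha> \<beta>) = D_weks \<alpha> \<beta>"
    using Q_weks_in_D_weks[OF assms] by auto
qed

section \<open>The subspace of extensions\<close>

lemma E_weks_in_D_weks:
  assumes f: "f \<in> C_ov" and ab: "\<alpha> + \<beta> > 0"
  shows "E_weks \<alpha> \<beta> f \<in> D_weks \<alpha> \<beta>"
proof -
  obtain l where "(f \<longlongrightarrow> l) (at_right 0)" "(f \<longlongrightarrow> - l) (at_left 0)"
    using f unfolding C_ov_def by blast
  then have "Lim (at_left 0) f = - l" "Lim (at_right 0) f = l"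
    by (auto intro!: tendsto_Lim)
  \<comment> \<open>At \<open>x = 0\<close> the first equation rests on the one-sided limits at 0
    being opposite.\<close>
  then have "E_left \<alpha> \<beta> f x + E_left \<alpha> \<beta> f (- x) = - (E_right \<alpha> \<beta> f x + E_right \<alpha> \<beta> f (- x))"
    "\<alpha> * (E_left \<alpha> \<beta> f x - E_left \<alpha> \<beta> f (- x)) = - (\<beta> * (E_right \<alpha> \<beta> f x - E_right \<alpha> \<beta> f (- x)))" for x
    using ab by (cases x "0::real" rule: linorder_cases;
        simp add: E_left_def E_right_def divide_simps; simp add: algebra_simps)+
  then have "(fst (E_weks \<alpha> \<beta> f), snd (E_weks \<alpha> \<beta> f)) \<in> D_weks \<alpha> \<beta>"
    unfolding D_weks_iff app_E_weks[OF f ab] by blast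
  then show ?thesis by simp
qed

text \<open>The preimage takes \<open>g\<close> on the left and \<open>h\<close> on the right; the
  two equations of \<open>D_weks\<close> then determine the other halves, and they agree with the
  extension formulas.\<close>

lemma D_weks_subset_range_E_weks:
  assumes ab: "\<alpha> + \<beta> > 0" and gh: "(g, h) \<in> D_weks \<alpha> \<beta>"
  shows "(g, h) \<in> E_weks \<alpha> \<beta> ` C_ov"
proof -
  define f where "f x = (if x < 0 then app g x else app h x)" for x
  have D: "app g x + app g (- x) = - (app h x + app h (- x))"
    "\<alpha> * (app g x - app g (- x)) = - (\<beta> * (app h x - app h (- x)))" for x
    using gh by (auto simp: D_weks_iff)
  \<comment> \<open>The even-part equation at 0 is what gives the glued function opposite one-sided
    limits.\<close>
  have zero: "app g 0 = - app h 0" using D(1)[of 0] by simp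
  obtain a b where a: "(app g \<longlongrightarrow> a) at_bot" and b: "(app h \<longlongrightarrow> b) at_top" using app_limits by metis
  have cg: "(app g \<longlongrightarrow> app g 0) (at 0)" and ch: "(app h \<longlongrightarrow> app h 0) (at 0)"
    using continuous_app_UNIV by (auto simp: continuous_on_def)
  have left: "(f \<longlongrightarrow> - app h 0) (at_left 0)"
    unfolding zero[symmetric]
    by (rule Lim_transform_eventually[OF filterlim_mono[OF cg order_refl at_le]])
       (auto simp: f_def eventually_at_filter)
  have right: "(f \<longlongrightarrow> app h 0) (at_right 0)"
    by (rule Lim_transform_eventually[OF filterlim_mono[OF ch order_refl at_le]])
       (auto simp: f_def eventually_at_filter)
  have Lims: "Lim (at_left 0) f = app g 0" "Lim (at_right 0) f = app h 0"
    using left right zero by (auto intro!: tendsto_Lim)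
  have "continuous_on ({..<0} \<union> {0<..}) f"
    unfolding f_def
    by (intro continuous_on_open_Un)
       (auto intro!: continuous_on_cong[THEN iffD1, OF refl _ continuous_on_subset[OF continuous_app_UNIV subset_UNIV]])
  moreover have "{..<0} \<union> {0<..} = - {0 :: real}" by auto
  moreover have "(f \<longlongrightarrow> a) at_bot"
    by (rule Lim_transform_eventually[OF a])
       (rule eventually_mono[OF eventually_gt_at_bot[of 0]], simp add: f_def)
  moreover have "(f \<longlongrightarrow> b) at_top"
    by (rule Lim_transform_eventually[OF b])
       (rule eventually_mono[OF eventually_gt_at_top[of 0]], simp add: f_def)
  ultimately have f: "f \<in> C_ov"
    unfolding C_ov_def using left right by auto
  have "E_left \<alpha> \<beta> f x = app g x" for x
  proof (cases x "0::real" rule: linorder_cases)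
    case greater
    \<comment> \<open>Eliminate \<open>app h (- x)\<close> between the two equations and solve for
      \<open>app g x\<close>; the other coordinate below is symmetric.\<close>
    have "(\<alpha> + \<beta>) * app g x = (\<alpha> - \<beta>) * app g (- x) - 2 * \<beta> * app h x"
    proof -
      have "app h (- x) = - app h x - app g x - app g (- x)" using D(1)[of x] by simp
      then show ?thesis using D(2)[of x] unfolding \<open>app h (- x) = _\<close> by (simp add: algebra_simps)
    qed
    then have "app g x = ((\<alpha> - \<beta>) * app g (- x) - 2 * \<beta> * app h x) / (\<alpha> + \<beta>)"
      using ab by (simp add: eq_divide_eq mult.commute)
    then show ?thesis using greater by (simp add: E_left_def f_def left_diff_distrib diff_divide_distrib)
  qed (simp_all add: E_left_def f_def Lims)
  moreover have "E_right \<alpha> \<beta> f x = app h x" for x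
  proof (cases x "0::real" rule: linorder_cases)
    case less
    have "(\<alpha> + \<beta>) * app h x = (\<beta> - \<alpha>) * app h (- x) - 2 * \<alpha> * app g x"
    proof -
      have "app g (- x) = - app g x - app h x - app h (- x)" using D(1)[of x] by simp
      then show ?thesis using D(2)[of x] unfolding \<open>app g (- x) = _\<close> by (simp add: algebra_simps)
    qed
    then have "app h x = ((\<beta> - \<alpha>) * app h (- x) - 2 * \<alpha> * app g x) / (\<alpha> + \<beta>)"
      using ab by (simp add: eq_divide_eq mult.commute)
    then show ?thesis using less by (simp add: E_right_def f_def left_diff_distrib diff_divide_distrib)
  qed (simp_all add: E_right_def f_def Lims)
  ultimately have "(g, h) = E_weks \<alpha> \<beta> f"
    using app_E_weks[OF f ab] by (auto simp: prod_eq_iff intro!: lim_cont_eqI)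
  then show ?thesis using f by blast
qed

theorem theorem6p2:
  fixes \<alpha> \<beta> :: real
  assumes "\<alpha> \<ge> 0" "\<beta> \<ge> 0" "\<alpha> + \<beta> > 0"
  shows "(\<forall>F. (\<lambda>n. Q (real n * \<alpha>) (real n * \<beta>) F) \<longlonglongrightarrow> Q_weks \<alpha> \<beta> F)
       \<and> is_projection_on (Q_weks \<alpha> \<beta>) (D_weks \<alpha> \<beta>)
       \<and> D_weks \<alpha> \<beta> = E_weks \<alpha> \<beta> ` C_ov"
proof (intro conjI allI)
  show "(\<lambda>n. Q (real n * \<alpha>) (real n * \<beta>) F) \<longlonglongrightarrow> Q_weks \<alpha> \<beta> F" for F
    unfolding Q_def Q_weks_def by (intro tendsto_diff tendsto_const P_tendsto_P_skew assms)
  show "is_projection_on (Q_weks \<alpha> \<beta>) (D_weks \<alpha> \<beta>)" by (rule is_projection_on_Q_weks[OF assms(3)])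
  show "D_weks \<alpha> \<beta> = E_weks \<alpha> \<beta> ` C_ov"
    using E_weks_in_D_weks[OF _ assms(3)] D_weks_subset_range_E_weks[OF assms(3)] by auto
qed

end
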